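(* Let $\tilde{\mathbb W}_\Gamma$, $\mathbb G_\Gamma$, $\mathbb Q_\Gamma$ be such that: (1) $\tilde{\mathbb W}\subset H^1(\Omega)$ and $\mathbb G\subset H^1(\Omega)^d$ are finite-dimensional subspaces, $\tilde{\mathbb W}_\Gamma=\tilde{\mathbb W}\cap H^1_\Gamma(\Omega)$ and $\mathbb G_\Gamma=\mathbb G\cap\mathbf G_\Gamma(\Omega)$; (2) $\mathbb Q_\Gamma=\operatorname{Im}\boldsymbol\Xi_X$, where $\boldsymbol\Xi_X(\tilde v,\boldsymbol\psi)=\nabla\tilde v-\boldsymbol\psi$ on $\tilde{\mathbb W}_\Gamma\times\mathbb G_\Gamma$; (3) with $\mathbb W_\Gamma:=\{v\in\tilde{\mathbb W}_\Gamma:\nabla v\in\mathbb G_\Gamma\}\subset H^2_\Gamma(\Omega)$, one has $\alpha_X:=\inf_{0\ne u\in\mathbb W_\Gamma}\sup_{0\ne v\in\mathbb W_\Gamma}\frac{B(u,v)}{\|u\|_2\|v\|_2}>0$. Then for any $F_1\in\mathbb G_\Gamma^*$ and $F_2\in\tilde{\mathbb W}_\Gamma^*$, the problem of finding $(\tilde w_X,\boldsymbol\gamma_X,\mathbf q_X)\in\tilde{\mathbb W}_\Gamma\times\mathbb G_\Gamma\times\mathbb Q_\Gamma$ such that $$a(\boldsymbol\gamma_X,\boldsymbol\psi)+c(\tilde w_X,\tilde v)+(\boldsymbol\Xi_X(\tilde v,\boldsymbol\psi),\mathbf q_X)_{\mathrm{curl}}=F_1(\boldsymbol\psi)+F_2(\tilde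 v)\quad\forall(\tilde v,\boldsymbol\psi)\in\tilde{\mathbb W}_\Gamma\times\mathbb G_\Gamma,$$ $$(\boldsymbol\Xi_X(\tilde w_X,\boldsymbol\gamma_X),\boldsymbol\eta)_{\mathrm{curl}}=0\quad\forall\boldsymbol\eta\in\mathbb Q_\Gamma$$ has a unique solution, and it satisfies $\tilde w_X=w_X$ and $\boldsymbol\gamma_X=\nabla w_X$, where $w_X\in\mathbb W_\Gamma$ is the $H^2$-conforming approximation defined by $$B(w_X,v)=F_1(\nabla v)+F_2(v)\quad\forall v\in\mathbb W_\Gamma.$$ In particular, $w_X$ is independent of the choice of the splitting $B(w,v)=a(\nabla w,\nabla v)+c(w,v)$ of the bilinear form $B$.
   Context: Geometry: $d\in\{2,3\}$ and $\Omega\subset\mathbb{R}^d$ is a connected Lipschitz polyhedral domain whose boundary $\Gamma=\partial\Omega$ is partitioned into disjoint sets $\Gamma_c,\Gamma_s,\Gamma_f$; $\Gamma_{cs}:=\Gamma_c\cup\Gamma_s$; $\mathbf n$ is the unit outward normal. For $d=2$: there are simply connected Lipschitz polygons $\Omega_0,\dots,\Omega_{N_H}$ with $\bar\Omega_j\subsetneq\Omega_0$ for $1\le j\le N_H$, $\bar\Omega_i\cap\bar\Omega_j=\emptyset$ for $1\le i\neq j\le N_H$, and $\Omega=\Omega_0\setminus\bigcup_{j=1}^{N_H}\bar\Omega_j$. For $d=3$: for each connected component $\Gamma_{cs}^{(i)}$, $1\le i\le N$, of $\Gamma_{cs}$ there is an open Lipschitz domain $\Omega_i\subset\mathbb{R}^3$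 with $\bar\Omega_i\cap\bar\Omega=\bar\Gamma_{cs}^{(i)}$, $\Omega_i\cap\Omega=\emptyset$, the distance between $\Omega_i$ and $\Omega_j$ is strictly positive for $i\ne j$, and $\bar\Omega\cup\bar\Omega_1\cup\dots\cup\bar\Omega_N$ is a Lipschitz domain. Spaces: $\|\cdot\|_k$ is the $H^k(\Omega)$ norm (for vector fields, $\|\cdot\|_1$ is the sum of the $H^1$-norms of the components). $H^2_\Gamma(\Omega)=\{v\in H^2(\Omega): v|_{\Gamma_{cs}}=0,\ \partial_n v|_{\Gamma_c}=0\}$; $H^1_\Gamma(\Omega)=\{v\in H^1(\Omega): v|_{\Gamma_{cs}}=0\}$; $\mathbf G_\Gamma(\Omega)=\{\boldsymbol\psi\in H^1(\Omega)^d: \boldsymbol\psi|_{\Gamma_c}=\mathbf 0,\ \boldsymbol\pi_T\boldsymbol\psi|_{\Gamma_s}=\mathbf 0\}$ with $\boldsymbol\pi_T\boldsymbol\psi=\boldsymbol\psi-(\boldsymbol\psi\cdot\mathbf n)\mathbf n$. $(\boldsymbol\theta,\boldsymbol\eta)_{\mathrm{curl}}=(\boldsymbol\theta,\boldsymbol\eta)+(\mathrm{curl}\,\boldsymbol\theta,\mathrm{curl}\,\boldsymbol\eta)$, with $(\cdot,\cdot)$ the $L^2(\Omega)$ inner product and $\mathrm{curl}$ the scalar curl $\partial_x\theta_2-\partial_y\theta_1$ if $d=2$, the usual curl if $d=3$. Bilinear form: $B:H^2(\Omega)\times H^2(\Omega)\to\mathbb R$ is bilinear with (i) $|B(u,v)|\le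 M_B\|u\|_2\|v\|_2$ for all $u,v\in H^2(\Omega)$, for some $M_B>0$; (ii) $\inf_{0\ne u\in H^2_\Gamma(\Omega)}\sup_{0\ne v\in H^2_\Gamma(\Omega)}\frac{B(u,v)}{\|u\|_2\|v\|_2}\ge\alpha$ for some $\alpha>0$; (iii) $\sup_{u\in H^2_\Gamma(\Omega)}B(u,v)>0$ for every $0\neq v\in H^2_\Gamma(\Omega)$. Moreover $B(w,v)=a(\nabla w,\nabla v)+c(w,v)$ for all $w,v\in H^2(\Omega)$, where $a$ and $c$ are bilinear forms on $H^1(\Omega)^d$ and $H^1(\Omega)$ with $|a(\boldsymbol\theta,\boldsymbol\psi)|\le M\|\boldsymbol\theta\|_1\|\boldsymbol\psi\|_1$ and $|c(w,v)|\le M\|w\|_1\|v\|_1$ for some $M>0$ (such a splitting need not be unique). *)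

theory Defs
  imports "HOL-Analysis.Analysis"
begin

section \<open>Square-integrable functions modulo null sets\<close>

definition square_integrable :: "('a::euclidean_space \<Rightarrow> real) \<Rightarrow> bool" where
  "square_integrable f \<longleftrightarrow> f \<in> borel_measurable lborel \<and> integrable lborel (\<lambda>x. (f x)\<^sup>2)"

definition l2_eq :: "('a::euclidean_space \<Rightarrow> real) \<Rightarrow> ('a \<Rightarrow> real) \<Rightarrow> bool" where
  "l2_eq f g \<longleftrightarrow> square_integrable f \<and> square_integrable g \<and> (AE x in lborel. f x = g x)"

lemma square_integrable_measurable [measurable_dest]:
  "square_integrable f \<Longrightarrow> f \<in> borel_measurable lborel"
  by (simp add: square_integrable_def)

lemma integrable_mult_square_integrable:
  assumes f: "square_integrable f" and g: "square_integrable g"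
  shows "integrable lborel (\<lambda>x. f x * g x)"
proof (rule Bochner_Integration.integrable_bound)
  show "integrable lborel (\<lambda>x. (f x)\<^sup>2 + (g x)\<^sup>2)"
    using f g by (auto simp: square_integrable_def)
  show "(\<lambda>x. f x * g x) \<in> borel_measurable lborel"
    using f g by (auto simp: square_integrable_def)
  have "norm (f x * g x) \<le> norm ((f x)\<^sup>2 + (g x)\<^sup>2)" for x
  proof -
    have "2 * (\<bar>f x\<bar> * \<bar>g x\<bar>) \<le> (f x)\<^sup>2 + (g x)\<^sup>2"
      using sum_squares_bound[of "\<bar>f x\<bar>" "\<bar>g x\<bar>"] by simp
    moreover have "0 \<le> \<bar>f x\<bar> * \<bar>g x\<bar>" by simp
    ultimately have "\<bar>f x\<bar> * \<bar>g x\<bar> \<le> (f x)\<^sup>2 + (g x)\<^sup>2" by linarith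
    then show ?thesis by (simp add: abs_mult)
  qed
  then show "AE x in lborel. norm (f x * g x) \<le> norm ((f x)\<^sup>2 + (g x)\<^sup>2)" by simp
qed

lemma square_integrable_zero: "square_integrable (\<lambda>x. 0)"
  by (simp add: square_integrable_def)

lemma square_integrable_add:
  assumes "square_integrable f" "square_integrable g"
  shows "square_integrable (\<lambda>x. f x + g x)"
  using assms integrable_mult_square_integrable[OF assms]
  by (auto simp: square_integrable_def power2_sum mult.assoc)

lemma square_integrable_scale:
  assumes "square_integrable f"
  shows "square_integrable (\<lambda>x. c * f x)"
  using assms by (auto simp: square_integrable_def power_mult_distrib)

text \<open>An element of \<open>'a l2\<close> is a class of real-valued square-integrable functions on the whole
  space \<open>'a\<close>, equal almost everywhere. Functions on a set \<open>\<Omega>\<close> are represented by their extension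
  by zero, see \<open>L2\<close> below. \<open>rep_l2\<close> picks a representative.\<close>

quotient_type (overloaded) 'a l2 = "'a::euclidean_space \<Rightarrow> real" / partial: l2_eq
proof (rule part_equivpI)
  show "\<exists>f::'a \<Rightarrow> real. l2_eq f f"
    using square_integrable_zero by (auto simp: l2_eq_def intro!: exI[of _ "\<lambda>x. 0"])
  show "symp (l2_eq :: ('a \<Rightarrow> real) \<Rightarrow> _)"
    by (auto simp: l2_eq_def symp_def elim: eventually_mono)
  show "transp (l2_eq :: ('a \<Rightarrow> real) \<Rightarrow> _)"
    unfolding l2_eq_def transp_def by (auto elim: eventually_elim2)
qed

instantiation l2 :: (euclidean_space) real_inner
begin

lift_definition zero_l2 :: "'a l2" is "\<lambda>x. 0"
  by (simp add: l2_eq_def square_integrable_zero)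

lift_definition plus_l2 :: "'a l2 \<Rightarrow> 'a l2 \<Rightarrow> 'a l2" is "\<lambda>f g x. f x + g x"
  by (auto simp: l2_eq_def square_integrable_add elim: eventually_elim2)

lift_definition scaleR_l2 :: "real \<Rightarrow> 'a l2 \<Rightarrow> 'a l2" is "\<lambda>c f x. c * f x"
  by (auto simp: l2_eq_def square_integrable_scale elim: eventually_mono)

definition uminus_l2 :: "'a l2 \<Rightarrow> 'a l2" where "uminus_l2 f = (-1) *\<^sub>R f"

definition minus_l2 :: "'a l2 \<Rightarrow> 'a l2 \<Rightarrow> 'a l2" where "minus_l2 f g = f + (- g)"

lift_definition inner_l2 :: "'a l2 \<Rightarrow> 'a l2 \<Rightarrow> real" is "\<lambda>f g. \<integral>x. f x * g x \<partial>lborel"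
proof -
  fix f f' g g' :: "'a \<Rightarrow> real"
  assume "l2_eq f f'" "l2_eq g g'"
  then have 1: "f \<in> borel_measurable lborel" "f' \<in> borel_measurable lborel"
      "g \<in> borel_measurable lborel" "g' \<in> borel_measurable lborel"
    and 2: "AE x in lborel. f x = f' x" "AE x in lborel. g x = g' x"
    by (auto simp: l2_eq_def square_integrable_def)
  from 2 have "AE x in lborel. f x * g x = f' x * g' x" by (auto elim: eventually_elim2)
  then show "(\<integral>x. f x * g x \<partial>lborel) = (\<integral>x. f' x * g' x \<partial>lborel)"
    using 1 by (intro integral_cong_AE) auto
qed

definition norm_l2 :: "'a l2 \<Rightarrow> real" where "norm_l2 f = sqrt (inner f f)"

definition dist_l2 :: "'a l2 \<Rightarrow> 'a l2 \<Rightarrow> real" where "dist_l2 f g = norm (f - g)"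

definition sgn_l2 :: "'a l2 \<Rightarrow> 'a l2" where "sgn_l2 f = inverse (norm f) *\<^sub>R f"

definition uniformity_l2 :: "('a l2 \<times> 'a l2) filter" where
  "uniformity_l2 = (INF e\<in>{0<..}. principal {(x, y). dist x y < e})"

definition open_l2 :: "'a l2 set \<Rightarrow> bool" where
  "open_l2 U \<longleftrightarrow> (\<forall>x\<in>U. eventually (\<lambda>(x', y). x' = x \<longrightarrow> y \<in> U) uniformity)"

instance
proof
  fix f g h :: "'a l2" and r s :: real
  show "f + g + h = f + (g + h)"
    by transfer (auto simp: l2_eq_def square_integrable_add add.assoc)
  show comm: "f + g = g + f" for f g :: "'a l2"
    by transfer (auto simp: l2_eq_def square_integrable_add add.commute)
  show "0 + f = f"
    by transfer (auto simp: l2_eq_def)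
  show "- f + f = 0"
    unfolding uminus_l2_def
    by transfer (simp add: l2_eq_def square_integrable_zero)
  show "f - g = f + - g" by (fact minus_l2_def)
  show "r *\<^sub>R (f + g) = r *\<^sub>R f + r *\<^sub>R g"
    by transfer (auto simp: l2_eq_def square_integrable_add square_integrable_scale distrib_left)
  show "(r + s) *\<^sub>R f = r *\<^sub>R f + s *\<^sub>R f"
    by transfer (auto simp: l2_eq_def square_integrable_add square_integrable_scale distrib_right)
  show "r *\<^sub>R s *\<^sub>R f = (r * s) *\<^sub>R f"
    by transfer (auto simp: l2_eq_def square_integrable_scale mult.assoc)
  show "1 *\<^sub>R f = f"
    by transfer (auto simp: l2_eq_def)
  show "dist f g = norm (f - g)" by (fact dist_l2_def)
  show "sgn f = inverse (norm f) *\<^sub>R f" by (fact sgn_l2_def)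
  show "uniformity = (INF e\<in>{0<..}. principal {(x, y). dist (x::'a l2) y < e})"
    by (fact uniformity_l2_def)
  show "open U \<longleftrightarrow> (\<forall>x\<in>U. eventually (\<lambda>(x', y). x' = x \<longrightarrow> y \<in> U) uniformity)"
    for U :: "'a l2 set"
    by (fact open_l2_def)
  show "inner f g = inner g f"
    by transfer (simp add: mult.commute)
  show "inner (f + g) h = inner f h + inner g h"
    by transfer (auto simp: l2_eq_def distrib_right integrable_mult_square_integrable)
  show "inner (r *\<^sub>R f) g = r * inner f g"
    by transfer (simp add: mult.assoc)
  show "0 \<le> inner f f"
    by transfer simp
  show "inner f f = 0 \<longleftrightarrow> f = 0"
  proof transfer
    fix f :: "'a \<Rightarrow> real"
    assume "l2_eq f f"
    then have f: "square_integrable f" by (simp add: l2_eq_def)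
    have "(\<integral>x. f x * f x \<partial>lborel) = 0 \<longleftrightarrow> (AE x in lborel. f x * f x = 0)"
      using integrable_mult_square_integrable[OF f f] by (intro integral_nonneg_eq_0_iff_AE) auto
    then show "(\<integral>x. f x * f x \<partial>lborel) = 0 \<longleftrightarrow> l2_eq f (\<lambda>x. 0)"
      using f by (simp add: l2_eq_def square_integrable_zero)
  qed
  show "norm f = sqrt (inner f f)" by (fact norm_l2_def)
qed

end

lemma square_integrable_rep_l2: "square_integrable (rep_l2 f)"
  using Quotient3_rep_reflp[OF Quotient3_l2, of f] by (simp add: l2_eq_def)

lemma abs_rep_l2: "abs_l2 (rep_l2 f) = f"
  by (rule Quotient3_abs_rep[OF Quotient3_l2])

lemma AE_rep_abs_l2:
  assumes "square_integrable f"
  shows "AE x in lborel. rep_l2 (abs_l2 f) x = f x"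
  using rep_abs_rsp_left[OF Quotient3_l2, of f f] assms by (simp add: l2_eq_def)

lemma l2_eq_iff_AE: "f = g \<longleftrightarrow> (AE x in lborel. rep_l2 f x = rep_l2 g x)"
  using Quotient3_rel_rep[OF Quotient3_l2, of f g] square_integrable_rep_l2
  by (auto simp: l2_eq_def)

lemma inner_l2_eq_integral:
  fixes f g :: "'a::euclidean_space l2"
  shows "inner f g = (\<integral>x. rep_l2 f x * rep_l2 g x \<partial>lborel)"
proof -
  have "l2_eq (rep_l2 h) (rep_l2 h)" for h :: "'a l2"
    by (simp add: l2_eq_def square_integrable_rep_l2)
  from inner_l2.abs_eq[OF this this, of f g] show ?thesis
    by (simp add: abs_rep_l2)
qed

definition L2 :: "'a::euclidean_space set \<Rightarrow> 'a l2 set" where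
  "L2 \<Omega> = {f. AE x in lborel. x \<notin> \<Omega> \<longrightarrow> rep_l2 f x = 0}"

definition restrict_l2 :: "'a::euclidean_space set \<Rightarrow> ('a \<Rightarrow> real) \<Rightarrow> 'a l2" where
  "restrict_l2 \<Omega> \<phi> = abs_l2 (\<lambda>x. indicator \<Omega> x * \<phi> x)"

section \<open>Weak derivatives and Sobolev spaces\<close>

definition partial_deriv :: "'n::finite \<Rightarrow> (real^'n \<Rightarrow> real) \<Rightarrow> real^'n \<Rightarrow> real" where
  "partial_deriv i \<phi> x = frechet_derivative \<phi> (at x) (axis i 1)"

fun Ck :: "nat \<Rightarrow> (real^'n::finite \<Rightarrow> real) \<Rightarrow> bool" where
  "Ck 0 \<phi> \<longleftrightarrow> continuous_on UNIV \<phi>"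
| "Ck (Suc k) \<phi> \<longleftrightarrow> (\<forall>x. \<phi> differentiable (at x)) \<and> (\<forall>i. Ck k (partial_deriv i \<phi>))"

definition smooth :: "(real^'n::finite \<Rightarrow> real) \<Rightarrow> bool" where
  "smooth \<phi> \<longleftrightarrow> (\<forall>k. Ck k \<phi>)"

definition test_function :: "(real^'n::finite) set \<Rightarrow> (real^'n \<Rightarrow> real) \<Rightarrow> bool" where
  "test_function \<Omega> \<phi> \<longleftrightarrow>
     smooth \<phi> \<and> compact (closure {x. \<phi> x \<noteq> 0}) \<and> closure {x. \<phi> x \<noteq> 0} \<subseteq> \<Omega>"

definition has_weak_pderiv ::
    "(real^'n::finite) set \<Rightarrow> 'n \<Rightarrow> (real^'n) l2 \<Rightarrow> (real^'n) l2 \<Rightarrow> bool" where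
  "has_weak_pderiv \<Omega> i f g \<longleftrightarrow> g \<in> L2 \<Omega> \<and>
     (\<forall>\<phi>. test_function \<Omega> \<phi> \<longrightarrow>
        (\<integral>x. rep_l2 f x * partial_deriv i \<phi> x \<partial>lborel) = - (\<integral>x. rep_l2 g x * \<phi> x \<partial>lborel))"

definition weak_pderiv :: "(real^'n::finite) set \<Rightarrow> 'n \<Rightarrow> (real^'n) l2 \<Rightarrow> (real^'n) l2" where
  "weak_pderiv \<Omega> i f = (THE g. has_weak_pderiv \<Omega> i f g)"

text \<open>Vector fields in \<open>L\<^sup>2(\<Omega>)\<^sup>d\<close> are vectors of classes, of type \<open>(real^'n) l2 ^ 'n\<close>; the library
  inner product on that type is the \<open>L\<^sup>2\<close> inner product of vector fields.\<close>

definition weak_grad :: "(real^'n::finite) set \<Rightarrow> (real^'n) l2 \<Rightarrow> (real^'n) l2 ^ 'n" where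
  "weak_grad \<Omega> f = (\<chi> i. weak_pderiv \<Omega> i f)"

definition H1 :: "(real^'n::finite) set \<Rightarrow> (real^'n) l2 set" where
  "H1 \<Omega> = {f \<in> L2 \<Omega>. \<forall>i. \<exists>g. has_weak_pderiv \<Omega> i f g}"

definition H2 :: "(real^'n::finite) set \<Rightarrow> (real^'n) l2 set" where
  "H2 \<Omega> = {f \<in> H1 \<Omega>. \<forall>i. weak_pderiv \<Omega> i f \<in> H1 \<Omega>}"

definition H1_vec :: "(real^'n::finite) set \<Rightarrow> ((real^'n) l2 ^ 'n) set" where
  "H1_vec \<Omega> = {\<psi>. \<forall>i. \<psi> $ i \<in> H1 \<Omega>}"

definition norm_H1 :: "(real^'n::finite) set \<Rightarrow> (real^'n) l2 \<Rightarrow> real" where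
  "norm_H1 \<Omega> f = sqrt ((norm f)\<^sup>2 + (\<Sum>i\<in>UNIV. (norm (weak_pderiv \<Omega> i f))\<^sup>2))"

definition norm_H1_vec :: "(real^'n::finite) set \<Rightarrow> (real^'n) l2 ^ 'n \<Rightarrow> real" where
  "norm_H1_vec \<Omega> \<psi> = (\<Sum>i\<in>UNIV. norm_H1 \<Omega> (\<psi> $ i))"

text \<open>The second-order part is the \<open>L\<^sup>2\<close> norm of the full Hessian.\<close>

definition norm_H2 :: "(real^'n::finite) set \<Rightarrow> (real^'n) l2 \<Rightarrow> real" where
  "norm_H2 \<Omega> f = sqrt ((norm f)\<^sup>2 + (\<Sum>i\<in>UNIV. (norm (weak_pderiv \<Omega> i f))\<^sup>2)
     + (\<Sum>i\<in>UNIV. \<Sum>j\<in>UNIV. (norm (weak_pderiv \<Omega> j (weak_pderiv \<Omega> i f)))\<^sup>2))"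

section \<open>The curl\<close>

text \<open>\<open>has_weak_rot \<Omega> i j \<theta> \<kappa>\<close> says \<open>\<kappa> = \<partial>\<^sub>i \<theta>\<^sub>j - \<partial>\<^sub>j \<theta>\<^sub>i\<close> in the sense of distributions on \<open>\<Omega>\<close>. The two partial
  derivatives need not exist separately in \<open>L\<^sup>2\<close>, as for \<open>\<theta> = \<nabla>v\<close> with \<open>v\<close> only in \<open>H\<^sup>1\<close>.\<close>

definition has_weak_rot ::
    "(real^'n::finite) set \<Rightarrow> 'n \<Rightarrow> 'n \<Rightarrow> (real^'n) l2 ^ 'n \<Rightarrow> (real^'n) l2 \<Rightarrow> bool" where
  "has_weak_rot \<Omega> i j \<theta> \<kappa> \<longleftrightarrow> \<kappa> \<in> L2 \<Omega> \<and>
     (\<forall>\<phi>. test_function \<Omega> \<phi> \<longrightarrow>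
        (\<integral>x. rep_l2 (\<theta> $ j) x * partial_deriv i \<phi> x - rep_l2 (\<theta> $ i) x * partial_deriv j \<phi> x \<partial>lborel)
          = - (\<integral>x. rep_l2 \<kappa> x * \<phi> x \<partial>lborel))"

definition weak_rot ::
    "(real^'n::finite) set \<Rightarrow> 'n \<Rightarrow> 'n \<Rightarrow> (real^'n) l2 ^ 'n \<Rightarrow> (real^'n) l2" where
  "weak_rot \<Omega> i j \<theta> = (THE \<kappa>. has_weak_rot \<Omega> i j \<theta> \<kappa>)"

text \<open>The bijection \<open>e\<close> from \<open>{1..d}\<close> to the index type names the coordinate axes
  \<open>x = e 1\<close>, \<open>y = e 2\<close>, \<open>z = e 3\<close>.\<close>

definition curl2 :: "(real^'n::finite) set \<Rightarrow> (nat \<Rightarrow> 'n) \<Rightarrow> (real^'n) l2 ^ 'n \<Rightarrow> (real^'n) l2" where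
  "curl2 \<Omega> e \<theta> = weak_rot \<Omega> (e 1) (e 2) \<theta>"

definition curl3 :: "(real^'n::finite) set \<Rightarrow> (nat \<Rightarrow> 'n) \<Rightarrow> (real^'n) l2 ^ 'n \<Rightarrow> (real^'n) l2 ^ 3" where
  "curl3 \<Omega> e \<theta> =
     vector [weak_rot \<Omega> (e 2) (e 3) \<theta>, weak_rot \<Omega> (e 3) (e 1) \<theta>, weak_rot \<Omega> (e 1) (e 2) \<theta>]"

definition inner_curl ::
    "(real^'n::finite) set \<Rightarrow> (nat \<Rightarrow> 'n) \<Rightarrow> (real^'n) l2 ^ 'n \<Rightarrow> (real^'n) l2 ^ 'n \<Rightarrow> real" where
  "inner_curl \<Omega> e \<theta> \<eta> = inner \<theta> \<eta> +
     (if CARD('n) = 2 then inner (curl2 \<Omega> e \<theta>) (curl2 \<Omega> e \<eta>)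
      else inner (curl3 \<Omega> e \<theta>) (curl3 \<Omega> e \<eta>))"

section \<open>Geometry\<close>

text \<open>Near each boundary point \<open>x\<close> the set is the part of a ball strictly below the graph of a
  Lipschitz function over the hyperplane orthogonal to the unit vector \<open>\<nu>\<close>. (Lipschitz functions
  on that hyperplane extend to the whole space, so \<open>g\<close> may be total.)\<close>

definition lipschitz_domain :: "'a::euclidean_space set \<Rightarrow> bool" where
  "lipschitz_domain \<Omega> \<longleftrightarrow> open \<Omega> \<and> connected \<Omega> \<and> \<Omega> \<noteq> {} \<and>
     (\<forall>x\<in>frontier \<Omega>. \<exists>r>0. \<exists>\<nu> g C. norm \<nu> = 1 \<and> C-lipschitz_on UNIV g \<and>
        \<Omega> \<inter> ball x r = {y \<in> ball x r. inner y \<nu> < g (y - inner y \<nu> *\<^sub>R \<nu>)})"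

definition polyhedral_lipschitz_domain :: "'a::euclidean_space set \<Rightarrow> bool" where
  "polyhedral_lipschitz_domain \<Omega> \<longleftrightarrow> lipschitz_domain \<Omega> \<and> bounded \<Omega> \<and>
     (\<exists>P. finite P \<and> (\<forall>p\<in>P. \<exists>a b. a \<noteq> 0 \<and> p = {x. inner a x = b}) \<and> frontier \<Omega> \<subseteq> \<Union>P)"

definition geometry_2d :: "'a::euclidean_space set \<Rightarrow> bool" where
  "geometry_2d \<Omega> \<longleftrightarrow> (\<exists>(N::nat) D.
     (\<forall>j\<le>N. polyhedral_lipschitz_domain (D j) \<and> simply_connected (D j)) \<and>
     (\<forall>j\<in>{1..N}. closure (D j) \<subset> D 0) \<and>
     (\<forall>i\<in>{1..N}. \<forall>j\<in>{1..N}. i \<noteq> j \<longrightarrow> closure (D i) \<inter> closure (D j) = {}) \<and>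
     \<Omega> = D 0 - (\<Union>j\<in>{1..N}. closure (D j)))"

text \<open>A closed set is called a Lipschitz domain when its interior is one.\<close>

definition geometry_3d :: "'a::euclidean_space set \<Rightarrow> 'a set \<Rightarrow> bool" where
  "geometry_3d \<Omega> \<Gamma>cs \<longleftrightarrow> finite (components \<Gamma>cs) \<and> (\<exists>D.
     (\<forall>S\<in>components \<Gamma>cs. lipschitz_domain (D S) \<and>
        closure (D S) \<inter> closure \<Omega> = closure S \<and> D S \<inter> \<Omega> = {}) \<and>
     (\<forall>S\<in>components \<Gamma>cs. \<forall>T\<in>components \<Gamma>cs. S \<noteq> T \<longrightarrow> setdist (D S) (D T) > 0) \<and>
     lipschitz_domain (interior (closure \<Omega> \<union> (\<Union>S\<in>components \<Gamma>cs. closure (D S)))))"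

definition boundary_partition :: "'a::euclidean_space set \<Rightarrow> 'a set \<Rightarrow> 'a set \<Rightarrow> 'a set \<Rightarrow> bool" where
  "boundary_partition \<Omega> \<Gamma>c \<Gamma>s \<Gamma>f \<longleftrightarrow> \<Gamma>c \<union> \<Gamma>s \<union> \<Gamma>f = frontier \<Omega> \<and>
     \<Gamma>c \<inter> \<Gamma>s = {} \<and> \<Gamma>c \<inter> \<Gamma>f = {} \<and> \<Gamma>s \<inter> \<Gamma>f = {}"

text \<open>Well defined at every boundary point in the relative interior of a flat face, that is at almost
  every point of the boundary of a polyhedral Lipschitz domain.\<close>

definition outward_normal :: "'a::euclidean_space set \<Rightarrow> 'a \<Rightarrow> 'a" where
  "outward_normal \<Omega> x = (THE n. norm n = 1 \<and>
     (\<exists>r>0. \<Omega> \<inter> ball x r = {y \<in> ball x r. inner n (y - x) < 0}))"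

section \<open>Surface measure and traces\<close>

text \<open>The \<open>s\<close>-dimensional Hausdorff measure, \<open>s \<ge> 1\<close>, on the Borel sets, normalised so as to give
  the surface area.\<close>

definition hausdorff_pre :: "nat \<Rightarrow> real \<Rightarrow> 'a::euclidean_space set \<Rightarrow> ennreal" where
  "hausdorff_pre s \<delta> A =
     (INF C\<in>{C :: nat \<Rightarrow> 'a set. A \<subseteq> (\<Union>i. C i) \<and> (\<forall>i. bounded (C i) \<and> diameter (C i) \<le> \<delta>)}.
        \<Sum>i. ennreal (unit_ball_vol (real s) * (diameter (C i) / 2) ^ s))"

definition hausdorff_measure :: "nat \<Rightarrow> 'a::euclidean_space measure" where
  "hausdorff_measure s = measure_of UNIV (sets borel) (\<lambda>A. SUP \<delta>\<in>{0<..}. hausdorff_pre s \<delta> A)"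

definition surface_measure :: "(real^'n::finite) measure" where
  "surface_measure = hausdorff_measure (CARD('n) - 1)"

text \<open>\<open>has_trace \<Omega> v g\<close>: the function \<open>g\<close> is a version of the trace of \<open>v \<in> H\<^sup>1(\<Omega>)\<close> on the boundary,
  that is, some smooth functions on the whole space converge to \<open>v\<close> in \<open>H\<^sup>1(\<Omega>)\<close> while their boundary
  values converge to \<open>g\<close> in \<open>L\<^sup>2\<close> of the boundary. By the trace theorem, for a bounded Lipschitz domain
  every \<open>v \<in> H\<^sup>1(\<Omega>)\<close> has such a \<open>g\<close>, and its values on the boundary are unique almost everywhere.\<close>

definition has_trace ::
    "(real^'n::finite) set \<Rightarrow> (real^'n) l2 \<Rightarrow> (real^'n \<Rightarrow> real) \<Rightarrow> bool" where
  "has_trace \<Omega> v g \<longleftrightarrow> g \<in> borel_measurable borel \<and>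
     (\<exists>\<phi> :: nat \<Rightarrow> real^'n \<Rightarrow> real. (\<forall>k. smooth (\<phi> k)) \<and>
        (\<lambda>k. restrict_l2 \<Omega> (\<phi> k)) \<longlonglongrightarrow> v \<and>
        (\<forall>i. (\<lambda>k. restrict_l2 \<Omega> (partial_deriv i (\<phi> k))) \<longlonglongrightarrow> weak_pderiv \<Omega> i v) \<and>
        (\<lambda>k. \<integral>\<^sup>+x\<in>frontier \<Omega>. ennreal ((\<phi> k x - g x)\<^sup>2) \<partial>surface_measure) \<longlonglongrightarrow> 0)"

definition has_trace_vec ::
    "(real^'n::finite) set \<Rightarrow> (real^'n) l2 ^ 'n \<Rightarrow> (real^'n \<Rightarrow> real^'n) \<Rightarrow> bool" where
  "has_trace_vec \<Omega> \<psi> g \<longleftrightarrow> (\<forall>i. has_trace \<Omega> (\<psi> $ i) (\<lambda>x. g x $ i))"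

definition tangential :: "'a::euclidean_space \<Rightarrow> 'a \<Rightarrow> 'a" where
  "tangential n y = y - inner y n *\<^sub>R n"

definition H1_\<Gamma> :: "(real^'n::finite) set \<Rightarrow> (real^'n) set \<Rightarrow> (real^'n) set \<Rightarrow> (real^'n) l2 set" where
  "H1_\<Gamma> \<Omega> \<Gamma>c \<Gamma>s = {v \<in> H1 \<Omega>.
     \<exists>g. has_trace \<Omega> v g \<and> (AE x in surface_measure. x \<in> \<Gamma>c \<union> \<Gamma>s \<longrightarrow> g x = 0)}"

definition H2_\<Gamma> :: "(real^'n::finite) set \<Rightarrow> (real^'n) set \<Rightarrow> (real^'n) set \<Rightarrow> (real^'n) l2 set" where
  "H2_\<Gamma> \<Omega> \<Gamma>c \<Gamma>s = {v \<in> H2 \<Omega>.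
     (\<exists>g. has_trace \<Omega> v g \<and> (AE x in surface_measure. x \<in> \<Gamma>c \<union> \<Gamma>s \<longrightarrow> g x = 0)) \<and>
     (\<exists>g. has_trace_vec \<Omega> (weak_grad \<Omega> v) g \<and>
        (AE x in surface_measure. x \<in> \<Gamma>c \<longrightarrow> inner (g x) (outward_normal \<Omega> x) = 0))}"

definition G_\<Gamma> :: "(real^'n::finite) set \<Rightarrow> (real^'n) set \<Rightarrow> (real^'n) set \<Rightarrow> ((real^'n) l2 ^ 'n) set" where
  "G_\<Gamma> \<Omega> \<Gamma>c \<Gamma>s = {\<psi> \<in> H1_vec \<Omega>. \<exists>g. has_trace_vec \<Omega> \<psi> g \<and>
     (AE x in surface_measure. x \<in> \<Gamma>c \<longrightarrow> g x = 0) \<and>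
     (AE x in surface_measure. x \<in> \<Gamma>s \<longrightarrow> tangential (outward_normal \<Omega> x) (g x) = 0)}"

section \<open>Bilinear forms\<close>

definition linear_form_on :: "'v::real_vector set \<Rightarrow> ('v \<Rightarrow> real) \<Rightarrow> bool" where
  "linear_form_on V F \<longleftrightarrow>
     (\<forall>x\<in>V. \<forall>y\<in>V. F (x + y) = F x + F y) \<and> (\<forall>r. \<forall>x\<in>V. F (r *\<^sub>R x) = r * F x)"

definition bilinear_form_on :: "'v::real_vector set \<Rightarrow> ('v \<Rightarrow> 'v \<Rightarrow> real) \<Rightarrow> bool" where
  "bilinear_form_on V b \<longleftrightarrow>
     (\<forall>x\<in>V. linear_form_on V (b x)) \<and> (\<forall>y\<in>V. linear_form_on V (\<lambda>x. b x y))"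

text \<open>Taken in the extended reals, so that the infimum over the empty set is \<open>\<infinity>\<close>.\<close>

definition inf_sup :: "('v::real_vector \<Rightarrow> real) \<Rightarrow> ('v \<Rightarrow> 'v \<Rightarrow> real) \<Rightarrow> 'v set \<Rightarrow> ereal" where
  "inf_sup nrm b V = (INF u\<in>V - {0}. SUP v\<in>V - {0}. ereal (b u v / (nrm u * nrm v)))"

definition splitting ::
    "(real^'n::finite) set \<Rightarrow> ((real^'n) l2 \<Rightarrow> (real^'n) l2 \<Rightarrow> real) \<Rightarrow>
     ((real^'n) l2 ^ 'n \<Rightarrow> (real^'n) l2 ^ 'n \<Rightarrow> real) \<Rightarrow> ((real^'n) l2 \<Rightarrow> (real^'n) l2 \<Rightarrow> real) \<Rightarrow> bool" where
  "splitting \<Omega> B a c \<longleftrightarrow>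
     bilinear_form_on (H1_vec \<Omega>) a \<and> bilinear_form_on (H1 \<Omega>) c \<and>
     (\<exists>M>0. (\<forall>\<theta>\<in>H1_vec \<Omega>. \<forall>\<psi>\<in>H1_vec \<Omega>. \<bar>a \<theta> \<psi>\<bar> \<le> M * norm_H1_vec \<Omega> \<theta> * norm_H1_vec \<Omega> \<psi>) \<and>
        (\<forall>w\<in>H1 \<Omega>. \<forall>v\<in>H1 \<Omega>. \<bar>c w v\<bar> \<le> M * norm_H1 \<Omega> w * norm_H1 \<Omega> v)) \<and>
     (\<forall>w\<in>H2 \<Omega>. \<forall>v\<in>H2 \<Omega>. B w v = a (weak_grad \<Omega> w) (weak_grad \<Omega> v) + c w v)"

section \<open>The mixed problem and the conforming problem\<close>

definition Xi :: "(real^'n::finite) set \<Rightarrow> (real^'n) l2 \<times> ((real^'n) l2 ^ 'n) \<Rightarrow> (real^'n) l2 ^ 'n" where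
  "Xi \<Omega> = (\<lambda>(v, \<psi>). weak_grad \<Omega> v - \<psi>)"

definition mixed_solution where
  "mixed_solution \<Omega> e a c F1 F2 W\<Gamma> G\<Gamma> Q\<Gamma> = (\<lambda>(w, \<gamma>, q).
     w \<in> W\<Gamma> \<and> \<gamma> \<in> G\<Gamma> \<and> q \<in> Q\<Gamma> \<and>
     (\<forall>v\<in>W\<Gamma>. \<forall>\<psi>\<in>G\<Gamma>. a \<gamma> \<psi> + c w v + inner_curl \<Omega> e (Xi \<Omega> (v, \<psi>)) q = F1 \<psi> + F2 v) \<and>
     (\<forall>\<eta>\<in>Q\<Gamma>. inner_curl \<Omega> e (Xi \<Omega> (w, \<gamma>)) \<eta> = 0))"

definition conforming_solution where
  "conforming_solution \<Omega> B F1 F2 W w \<longleftrightarrow>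
     w \<in> W \<and> (\<forall>v\<in>W. B w v = F1 (weak_grad \<Omega> v) + F2 v)"

end

theory Submission
  imports Defs
begin

text \<open>The curl inner product is positive definite, so testing the constraint with
  \<open>\<eta> = \<Xi>(w, \<gamma>)\<close> forces \<open>\<gamma> = \<nabla>w\<close>. Testing the first equation on the kernel
  \<open>{(v, \<nabla>v)}\<close> of \<open>\<Xi>\<close> then removes the multiplier and leaves exactly the conforming problem, which
  is uniquely solvable by finite dimensionality and the inf-sup condition. Conversely, for the conforming
  solution \<open>w\<close> the residual of the first equation vanishes on that kernel, hence factors through
  \<open>\<Xi>\<close> to a linear form on the image \<open>Q\<^sub>\<Gamma>\<close>; its Riesz representative in the curl inner
  product is the unique multiplier. Bilinearity of the curl product rests on uniqueness of
  weak derivatives, that is, on test functions separating the elements of \<open>L\<^sup>2(\<Omega>)\<close>.\<close>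

section \<open>Smooth functions and bump functions\<close>

text \<open>All weak derivatives are definite descriptions on classes modulo null sets, so nothing
  is linear for free: \<open>weak_pderiv\<close> and \<open>weak_rot\<close> obey the rules of
  calculus only where a derivative exists and is unique. Uniqueness is the fundamental lemma of the
  calculus of variations, and the explicit bump functions are built for it. Existence is delicate
  for the curl of \<open>weak_grad \<Omega> v - \<psi>\<close> with \<open>v\<close> merely in
  \<open>H1 \<Omega>\<close>: the separate second derivatives of \<open>v\<close> need not be square
  integrable, and only their antisymmetric combination exists, with value 0. This rests on the
  symmetry of second derivatives of test functions. Traces are existential statements, so the
  constrained spaces become subspaces by adding and scaling the approximating sequences together
  with the boundary values. The ambient spaces are infinite-dimensional; solvability is therefore
  phrased for a subspace inside the span of a finite set. Taking \<open>Q\<Gamma>\<close> to be the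
  image of \<open>Xi\<close> serves twice: the constraint residual is itself an admissible test
  field, and the first equation prescribes the curl product of the multiplier with every element of
  \<open>Q\<Gamma>\<close>.\<close>

lemma Ck_SucI:
  assumes "\<And>x. (\<phi> has_derivative D x) (at x)" "\<And>i. Ck k (\<lambda>x. D x (axis i 1))"
  shows "Ck (Suc k) \<phi>"
proof -
  \<comment> \<open>Derivatives are unique, so any computed \<open>D\<close> may stand in for the
    \<open>frechet_derivative\<close> inside \<open>partial_deriv\<close>.\<close>
  have "partial_deriv i \<phi> = (\<lambda>x. D x (axis i 1))" for i
    using frechet_derivative_at[OF assms(1)] by (auto simp: partial_deriv_def fun_eq_iff)
  with assms show ?thesis by (auto simp: differentiable_def)
qed

lemma Ck_SucD:
  assumes "Ck (Suc k) \<phi>"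
  shows "(\<phi> has_derivative frechet_derivative \<phi> (at x)) (at x)"
    and "Ck k (\<lambda>x. frechet_derivative \<phi> (at x) (axis i 1))"
proof -
  from assms have "\<phi> differentiable (at x)" "Ck k (partial_deriv i \<phi>)"
    unfolding Ck.simps(2) by blast+
  then show "(\<phi> has_derivative frechet_derivative \<phi> (at x)) (at x)"
    and "Ck k (\<lambda>x. frechet_derivative \<phi> (at x) (axis i 1))"
    by (simp_all only: partial_deriv_def[abs_def] frechet_derivative_works)
qed

text \<open>Needed for products: the product rule leaves undifferentiated factors, whose order has
  to be lowered by one.\<close>

lemma Ck_Suc_imp_Ck: "Ck (Suc k) \<phi> \<Longrightarrow> Ck k \<phi>"
proof (induction k arbitrary: \<phi>)
  case 0
  then show ?case
    by (simp add: continuous_on_eq_continuous_at differentiable_imp_continuous_within)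
next
  case (Suc k)
  from Suc.prems have "\<And>x. \<phi> differentiable (at x)" "\<And>i. Ck (Suc k) (partial_deriv i \<phi>)"
    using Ck.simps(2) by blast+
  then show ?case unfolding Ck.simps(2)[of k \<phi>] using Suc.IH by blast
qed

lemma Ck_const: "Ck k (\<lambda>x. c)"
proof (induction k arbitrary: c)
  case (Suc k)
  show ?case by (rule Ck_SucI[OF has_derivative_const]) (rule Suc.IH)
qed simp

lemma Ck_add: "Ck k \<phi> \<Longrightarrow> Ck k \<psi> \<Longrightarrow> Ck k (\<lambda>x. \<phi> x + \<psi> x)"
proof (induction k arbitrary: \<phi> \<psi>)
  case (Suc k)
  show ?case
    by (rule Ck_SucI[OF has_derivative_add[OF Suc.prems[THEN Ck_SucD(1)]]])
      (rule Suc.IH[OF Suc.prems[THEN Ck_SucD(2)]])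
qed (simp add: continuous_on_add)

lemma Ck_mult: "Ck k \<phi> \<Longrightarrow> Ck k \<psi> \<Longrightarrow> Ck k (\<lambda>x. \<phi> x * \<psi> x)"
proof (induction k arbitrary: \<phi> \<psi>)
  case (Suc k)
  show ?case
    by (rule Ck_SucI[OF has_derivative_mult[OF Suc.prems[THEN Ck_SucD(1)]]])
      (intro Ck_add Suc.IH Suc.prems[THEN Ck_SucD(2)] Suc.prems[THEN Ck_Suc_imp_Ck])
qed (simp add: continuous_on_mult)

lemma Ck_prod: "finite I \<Longrightarrow> (\<And>i. i \<in> I \<Longrightarrow> Ck k (\<phi> i)) \<Longrightarrow> Ck k (\<lambda>x. \<Prod>i\<in>I. \<phi> i x)"
  by (induction I rule: finite_induct) (auto intro: Ck_const Ck_mult)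

lemma partial_deriv_eq:
  "(\<phi> has_derivative D) (at x) \<Longrightarrow> partial_deriv i \<phi> x = D (axis i 1)"
  unfolding partial_deriv_def using frechet_derivative_at by metis

lemma smooth_has_derivative:
  "smooth \<phi> \<Longrightarrow> (\<phi> has_derivative frechet_derivative \<phi> (at x)) (at x)"
  unfolding smooth_def by (blast intro: Ck_SucD(1))

lemma smooth_partial_deriv: "smooth \<phi> \<Longrightarrow> smooth (partial_deriv i \<phi>)"
  unfolding smooth_def by (meson Ck.simps(2)[THEN iffD1])

lemma smooth_continuous_on: "smooth \<phi> \<Longrightarrow> continuous_on S \<phi>"
  using continuous_on_subset[OF _ subset_UNIV] Ck.simps(1) unfolding smooth_def by blast

lemma smooth_borel_measurable: "smooth \<phi> \<Longrightarrow> \<phi> \<in> borel_measurable borel"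
  by (intro borel_measurable_continuous_onI smooth_continuous_on)

lemma smooth_zero: "smooth (\<lambda>x. 0)"
  unfolding smooth_def by (blast intro: Ck_const)

lemma smooth_add: "smooth \<phi> \<Longrightarrow> smooth \<psi> \<Longrightarrow> smooth (\<lambda>x. \<phi> x + \<psi> x)"
  unfolding smooth_def by (blast intro: Ck_add)

lemma smooth_scale: "smooth \<phi> \<Longrightarrow> smooth (\<lambda>x. r * \<phi> x)"
  unfolding smooth_def by (intro allI Ck_mult Ck_const) blast

lemma partial_deriv_zero: "partial_deriv i (\<lambda>x. 0) = (\<lambda>x. 0)"
  by (simp add: partial_deriv_def[abs_def])

lemma partial_deriv_add:
  assumes "smooth \<phi>" "smooth \<psi>"
  shows "partial_deriv i (\<lambda>x. \<phi> x + \<psi> x) = (\<lambda>x. partial_deriv i \<phi> x + partial_deriv i \<psi> x)"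
  using partial_deriv_eq[OF has_derivative_add[OF assms[THEN smooth_has_derivative]]]
  by (simp add: partial_deriv_def fun_eq_iff)

lemma partial_deriv_scale:
  assumes "smooth \<phi>"
  shows "partial_deriv i (\<lambda>x. r * \<phi> x) = (\<lambda>x. r * partial_deriv i \<phi> x)"
  using partial_deriv_eq[OF has_derivative_mult_right[OF smooth_has_derivative[OF assms]]]
  by (simp add: partial_deriv_def fun_eq_iff)

section \<open>Symmetry of second partial derivatives\<close>

lemma partial_deriv_along_axis:
  assumes "smooth \<phi>"
  shows "((\<lambda>s. \<phi> (x + s *\<^sub>R axis i 1)) has_real_derivative partial_deriv i \<phi> (x + s *\<^sub>R axis i 1)) (at s)"
proof -
  have "((\<lambda>s. \<phi> (x + s *\<^sub>R axis i 1)) has_derivative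
      (\<lambda>h. frechet_derivative \<phi> (at (x + s *\<^sub>R axis i 1)) (h *\<^sub>R axis i 1))) (at s)"
    by (rule has_derivative_compose[OF _ smooth_has_derivative[OF assms]])
      (auto intro!: derivative_eq_intros)
  moreover have "linear (frechet_derivative \<phi> (at (x + s *\<^sub>R axis i 1)))"
    using smooth_has_derivative[OF assms] by (rule has_derivative_linear)
  ultimately show ?thesis
    by (simp add: has_field_derivative_def partial_deriv_def linear_scale mult.commute[of _ "frechet_derivative _ _ _"])
qed

text \<open>The mean value theorem is applied twice: along axis \<open>i\<close> to the increment in
  direction \<open>j\<close>, then along axis \<open>j\<close> to the partial derivative in
  direction \<open>i\<close>. The second difference is symmetric in \<open>i\<close> and
  \<open>j\<close>, which makes the two mixed derivatives comparable.\<close>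

lemma second_difference_mean_value:
  assumes "smooth \<phi>" "h > 0"
  obtains s t where "0 < s" "s < h" "0 < t" "t < h"
    and "\<phi> (x + h *\<^sub>R axis i 1 + h *\<^sub>R axis j 1) - \<phi> (x + h *\<^sub>R axis i 1) - \<phi> (x + h *\<^sub>R axis j 1) + \<phi> x
      = h\<^sup>2 * partial_deriv j (partial_deriv i \<phi>) (x + s *\<^sub>R axis i 1 + t *\<^sub>R axis j 1)"
proof -
  define u where "u s = \<phi> ((x + h *\<^sub>R axis j 1) + s *\<^sub>R axis i 1) - \<phi> (x + s *\<^sub>R axis i 1)" for s
  have "\<exists>s. s > 0 \<and> s < h \<and> u h - u 0 = (h - 0) * (partial_deriv i \<phi> ((x + h *\<^sub>R axis j 1) + s *\<^sub>R axis i 1)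
      - partial_deriv i \<phi> (x + s *\<^sub>R axis i 1))"
    unfolding u_def
    by (rule MVT2[OF assms(2)]) (intro DERIV_diff partial_deriv_along_axis assms)
  then obtain s where s: "s > 0" "s < h" and u: "u h - u 0 = h * (partial_deriv i \<phi> ((x + h *\<^sub>R axis j 1) + s *\<^sub>R axis i 1)
      - partial_deriv i \<phi> (x + s *\<^sub>R axis i 1))"
    by auto
  have "\<exists>t. t > 0 \<and> t < h \<and> partial_deriv i \<phi> ((x + s *\<^sub>R axis i 1) + h *\<^sub>R axis j 1)
      - partial_deriv i \<phi> ((x + s *\<^sub>R axis i 1) + 0 *\<^sub>R axis j 1)
      = (h - 0) * partial_deriv j (partial_deriv i \<phi>) ((x + s *\<^sub>R axis i 1) + t *\<^sub>R axis j 1)"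
    by (rule MVT2[OF assms(2)]) (intro partial_deriv_along_axis smooth_partial_deriv assms)
  then obtain t where t: "t > 0" "t < h" and v: "partial_deriv i \<phi> ((x + s *\<^sub>R axis i 1) + h *\<^sub>R axis j 1)
      - partial_deriv i \<phi> (x + s *\<^sub>R axis i 1)
      = h * partial_deriv j (partial_deriv i \<phi>) ((x + s *\<^sub>R axis i 1) + t *\<^sub>R axis j 1)"
    by auto
  show thesis
    using that[OF s t] u v unfolding u_def
    by (simp add: add_ac power2_eq_square algebra_simps)
qed

text \<open>Schwarz's theorem. Expanding one second difference in both orders gives points
  \<open>y\<close> and \<open>z\<close> near \<open>x\<close> at which the two mixed derivatives
  agree; shrinking the step and using continuity moves the equality to \<open>x\<close>.\<close>

lemma partial_deriv_commute:
  assumes "smooth \<phi>"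
  shows "partial_deriv j (partial_deriv i \<phi>) x = partial_deriv i (partial_deriv j \<phi>) x"
proof -
  define A where "A = partial_deriv j (partial_deriv i \<phi>)"
  define B where "B = partial_deriv i (partial_deriv j \<phi>)"
  have "\<exists>y z. norm (y - x) \<le> 2 * h \<and> norm (z - x) \<le> 2 * h \<and> A y = B z" if "h > 0" for h
  proof -
    obtain s t where 1: "0 < s" "s < h" "0 < t" "t < h"
      and eq1: "\<phi> (x + h *\<^sub>R axis i 1 + h *\<^sub>R axis j 1) - \<phi> (x + h *\<^sub>R axis i 1) - \<phi> (x + h *\<^sub>R axis j 1) + \<phi> x
      = h\<^sup>2 * A (x + s *\<^sub>R axis i 1 + t *\<^sub>R axis j 1)"
      using second_difference_mean_value[OF assms \<open>h > 0\<close>] unfolding A_def by blast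
    obtain s' t' where 2: "0 < s'" "s' < h" "0 < t'" "t' < h"
      and eq2: "\<phi> (x + h *\<^sub>R axis j 1 + h *\<^sub>R axis i 1) - \<phi> (x + h *\<^sub>R axis j 1) - \<phi> (x + h *\<^sub>R axis i 1) + \<phi> x
      = h\<^sup>2 * B (x + s' *\<^sub>R axis j 1 + t' *\<^sub>R axis i 1)"
      using second_difference_mean_value[OF assms \<open>h > 0\<close>] unfolding B_def by blast
    have "h\<^sup>2 * A (x + s *\<^sub>R axis i 1 + t *\<^sub>R axis j 1) = h\<^sup>2 * B (x + s' *\<^sub>R axis j 1 + t' *\<^sub>R axis i 1)"
      unfolding eq1[symmetric] eq2[symmetric] by (simp add: add_ac)
    then have "A (x + s *\<^sub>R axis i 1 + t *\<^sub>R axis j 1) = B (x + s' *\<^sub>R axis j 1 + t' *\<^sub>R axis i 1)"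
      using \<open>h > 0\<close> by simp
    \<comment> \<open>Two axis increments shorter than \<open>h\<close> separate each point from
      \<open>x\<close>, hence the factor 2.\<close>
    moreover have "norm (x + p *\<^sub>R axis k 1 + q *\<^sub>R axis l 1 - x) \<le> 2 * h"
      if "0 < p" "p < h" "0 < q" "q < h" for p q :: real and k l :: 'a
      using that norm_triangle_ineq[of "p *\<^sub>R axis k (1::real)" "q *\<^sub>R axis l 1"]
      by (simp add: add.assoc)
    ultimately show ?thesis using 1 2 by blast
  qed
  then have "\<forall>n. \<exists>y z. norm (y - x) \<le> 2 * inverse (real (Suc n)) \<and>
      norm (z - x) \<le> 2 * inverse (real (Suc n)) \<and> A y = B z"
    by simp
  then obtain y z where yz: "\<And>n. norm (y n - x) \<le> 2 * inverse (real (Suc n))"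
      "\<And>n. norm (z n - x) \<le> 2 * inverse (real (Suc n))" "\<And>n. A (y n) = B (z n)"
    by metis
  have lim: "(\<lambda>n. 2 * inverse (real (Suc n))) \<longlonglongrightarrow> 0"
    using tendsto_mult_right_zero[OF LIMSEQ_inverse_real_of_nat] .
  have "(\<lambda>n. y n - x) \<longlonglongrightarrow> 0" "(\<lambda>n. z n - x) \<longlonglongrightarrow> 0"
    using yz by (auto intro!: Lim_null_comparison[OF _ lim])
  then have yz_lim: "y \<longlonglongrightarrow> x" "z \<longlonglongrightarrow> x" by (auto dest: LIM_zero_cancel)
  have "isCont A x" "isCont B x"
    unfolding A_def B_def using assms
    by (auto intro!: smooth_continuous_on[of _ UNIV, THEN continuous_on_interior] smooth_partial_deriv)
  then have "(\<lambda>n. A (y n)) \<longlonglongrightarrow> A x" "(\<lambda>n. B (z n)) \<longlonglongrightarrow> B x"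
    using yz_lim by (auto intro: isCont_tendsto_compose)
  then show ?thesis unfolding yz(3) A_def[symmetric] B_def[symmetric] by (rule LIMSEQ_unique)
qed

section \<open>Flat exponentials and bump functions on boxes\<close>

text \<open>This family is closed under differentiation up to linear combinations, which makes the cutoff
  \<open>exp (- 1 / s)\<close> amenable to the recursion in \<open>Ck\<close>.\<close>

definition flat_exp :: "nat \<Rightarrow> real \<Rightarrow> real" where
  "flat_exp n s = (if s > 0 then exp (- inverse s) * inverse s ^ n else 0)"

text \<open>Substituting the inverse turns the right-hand limit into the decay of
  \<open>x ^ n / exp x\<close> at infinity; on the left the function is constantly 0.\<close>

lemma flat_exp_tendsto_0: "(flat_exp n \<longlongrightarrow> 0) (at 0)"
proof -
  have "((\<lambda>x. flat_exp n (inverse x)) \<longlongrightarrow> 0) at_top"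
    by (rule Lim_transform_eventually[OF tendsto_power_div_exp_0[of n]])
      (use eventually_gt_at_top[of "0::real"] in eventually_elim,
        auto simp: flat_exp_def exp_minus field_simps)
  then have "(flat_exp n \<longlongrightarrow> 0) (at_right 0)"
    by (simp add: filterlim_at_right_to_top)
  moreover have "(flat_exp n \<longlongrightarrow> 0) (at_left 0)"
    by (rule Lim_transform_eventually[OF tendsto_const])
      (auto simp: flat_exp_def eventually_at_left_field intro!: exI[of _ "-1"])
  ultimately show ?thesis by (simp add: filterlim_split_at)
qed

text \<open>For positive \<open>s\<close>, differentiating the exponential contributes two more
  inverse powers, whence \<open>n + 2\<close>; differentiating the power contributes one more and
  the factor \<open>- n\<close>.\<close>

lemma flat_exp_has_real_derivative:
  "(flat_exp n has_real_derivative flat_exp (n + 2) s - real n * flat_exp (n + 1) s) (at s)"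
proof (cases s "0::real" rule: linorder_cases)
  case less
  have "((\<lambda>s. 0::real) has_real_derivative flat_exp (n + 2) s - real n * flat_exp (n + 1) s) (at s)"
    using less by (auto simp: flat_exp_def)
  then show ?thesis
    by (rule has_field_derivative_transform_within_open[where S = "{..<0}"])
      (use less in \<open>simp_all add: flat_exp_def\<close>)
next
  case equal
  \<comment> \<open>Away from 0 the difference quotient is \<open>flat_exp (Suc n)\<close>, so the
    derivative at 0 is the limit already computed.\<close>
  have "((\<lambda>h. (flat_exp n h - flat_exp n 0) / (h - 0)) \<longlongrightarrow> 0) (at 0)"
    by (rule Lim_transform_eventually[OF flat_exp_tendsto_0[of "Suc n"]])
      (auto simp: flat_exp_def divide_inverse)
  with equal show ?thesis
    by (simp add: has_field_derivative_iff) (simp add: flat_exp_def)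
next
  case greater
  have "((\<lambda>s. exp (- inverse s) * inverse s ^ n) has_real_derivative
      flat_exp (n + 2) s - real n * flat_exp (n + 1) s) (at s)"
    using greater
    by (auto intro!: derivative_eq_intros simp: flat_exp_def power2_eq_square algebra_simps)
      (cases n; simp)
  then show ?thesis
    by (rule has_field_derivative_transform_within_open[where S = "{0<..}"])
      (use greater in \<open>simp_all add: flat_exp_def\<close>)
qed

text \<open>The derivative combines members of the same family with larger \<open>n\<close>, so the
  induction on \<open>k\<close> leaves \<open>n\<close> arbitrary. The factors of
  \<open>box_bump\<close> have exactly such an affine argument in one coordinate.\<close>

lemma Ck_flat_exp: "Ck k (\<lambda>x. flat_exp n (c * x $ i + d))"
proof (induction k arbitrary: n)
  case 0
  have "continuous_on UNIV (flat_exp n)"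
    using flat_exp_has_real_derivative by (intro DERIV_continuous_on) auto
  then show ?case
    unfolding Ck.simps
    by (rule continuous_on_compose2[where t = UNIV]) (intro continuous_intros, simp)
next
  case (Suc k)
  show ?case
  proof (rule Ck_SucI)
    fix x :: "real^'a"
    have "((\<lambda>x::real^'a. c * x $ i + d) has_derivative (\<lambda>h. c * h $ i)) (at x)"
      by (intro has_derivative_add_const has_derivative_mult_right
          bounded_linear_imp_has_derivative bounded_linear_vec_nth)
    from has_derivative_compose[OF this
        flat_exp_has_real_derivative[unfolded has_field_derivative_def]]
    show "((\<lambda>x. flat_exp n (c * x $ i + d)) has_derivative
       (\<lambda>h. (flat_exp (n + 2) (c * x $ i + d) + (- real n) * flat_exp (n + 1) (c * x $ i + d)) * (c * h $ i)))
       (at x)" by simp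
  qed (intro Ck_mult Ck_add Ck_const Suc)
qed

lemma flat_exp_0_bounds: "0 \<le> flat_exp 0 s" "flat_exp 0 s \<le> 1"
  by (auto simp: flat_exp_def)

text \<open>For positive \<open>s\<close> the argument tends to infinity, where
  \<open>exp (- inverse t)\<close> tends to 1; otherwise the argument is at most -1, where the
  function is 0.\<close>

lemma flat_exp_0_tendsto_indicator:
  "(\<lambda>k. flat_exp 0 (real k * s - 1)) \<longlonglongrightarrow> (if s > 0 then 1 else 0)"
proof (cases "s > 0")
  case True
  have lim: "filterlim (\<lambda>k. real k * s - 1) at_top sequentially"
    using filterlim_tendsto_add_at_top[OF tendsto_const[of "- 1"]
        filterlim_tendsto_pos_mult_at_top[OF tendsto_const True filterlim_real_sequentially]]
    by (simp add: mult.commute)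
  have "(\<lambda>k. exp (- inverse (real k * s - 1))) \<longlonglongrightarrow> exp (- 0)"
    by (intro tendsto_exp tendsto_minus tendsto_inverse_0_at_top lim)
  moreover have "eventually (\<lambda>k. exp (- inverse (real k * s - 1)) = flat_exp 0 (real k * s - 1)) sequentially"
    using filterlim_at_top_dense[THEN iffD1, OF lim, rule_format, of 0]
    by eventually_elim (simp add: flat_exp_def)
  ultimately have "(\<lambda>k. flat_exp 0 (real k * s - 1)) \<longlonglongrightarrow> exp (- 0)"
    by (rule Lim_transform_eventually)
  then show ?thesis using True by simp
next
  case False
  have "flat_exp 0 (real k * s - 1) = 0" for k
  proof -
    have "real k * s \<le> 0" using False by (simp add: mult_nonneg_nonpos)
    then show ?thesis by (simp add: flat_exp_def)
  qed
  then show ?thesis using False by simp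
qed

text \<open>The shifts by \<open>1\<close> keep the support a distance \<open>1 / k\<close> inside the open box, so it is compactly
  contained in the box.\<close>

definition box_bump :: "nat \<Rightarrow> real^'n \<Rightarrow> real^'n \<Rightarrow> real^'n::finite \<Rightarrow> real" where
  "box_bump k a b x =
     (\<Prod>i\<in>UNIV. flat_exp 0 (real k * (x $ i - a $ i) - 1) * flat_exp 0 (real k * (b $ i - x $ i) - 1))"

lemma smooth_box_bump: "smooth (box_bump k a b)"
proof -
  have "box_bump k a b = (\<lambda>x. \<Prod>i\<in>UNIV. flat_exp 0 (real k * x $ i + (- (real k * a $ i) - 1))
      * flat_exp 0 (- real k * x $ i + (real k * b $ i - 1)))"
    by (simp add: box_bump_def fun_eq_iff algebra_simps)
  then show ?thesis
    unfolding smooth_def by (simp only:) (intro allI Ck_prod Ck_mult Ck_flat_exp finite)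
qed

lemma box_bump_bounds: "0 \<le> box_bump k a b x" "box_bump k a b x \<le> 1"
  unfolding box_bump_def
  by (auto intro!: prod_nonneg prod_le_1 mult_nonneg_nonneg mult_le_one flat_exp_0_bounds)

text \<open>A nonzero value forces \<open>x\<close> to keep distance \<open>1 / k\<close> from every
  face, and the closed form of this condition survives the closure. For \<open>k = 0\<close> every
  factor is evaluated at -1, so the bump vanishes identically.\<close>

lemma box_bump_support: "closure {x. box_bump k a b x \<noteq> 0} \<subseteq> box a b"
proof (cases "k = 0")
  case True
  then have "{x. box_bump k a b x \<noteq> 0} = {}"
    by (auto simp: box_bump_def flat_exp_def)
  then show ?thesis by simp
next
  case False
  define r :: "real^'a" where "r = (\<chi> i. inverse (real k))"
  have "{x. box_bump k a b x \<noteq> 0} \<subseteq> cbox (a + r) (b - r)"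
  proof clarify
    fix x assume "box_bump k a b x \<noteq> 0"
    then have "real k * (x $ i - a $ i) - 1 > 0 \<and> real k * (b $ i - x $ i) - 1 > 0" for i
      by (auto simp: box_bump_def flat_exp_def split: if_splits)
    then show "x \<in> cbox (a + r) (b - r)"
      using False by (auto simp: mem_box_cart r_def field_simps intro!: less_imp_le)
  qed
  then have "closure {x. box_bump k a b x \<noteq> 0} \<subseteq> cbox (a + r) (b - r)"
    by (rule closure_minimal[OF _ closed_cbox])
  also have "\<dots> \<subseteq> box a b"
  proof
    fix x assume x: "x \<in> cbox (a + r) (b - r)"
    have "a $ i < x $ i \<and> x $ i < b $ i" for i
    proof -
      have "a $ i + inverse (real k) \<le> x $ i" "x $ i \<le> b $ i - inverse (real k)"
        using x by (auto simp: mem_box_cart r_def)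
      moreover have "inverse (real k) > 0" using False by simp
      ultimately show ?thesis by linarith
    qed
    then show "x \<in> box a b" by (simp add: mem_box_cart)
  qed
  finally show ?thesis .
qed

lemma test_function_box_bump:
  assumes "box a b \<subseteq> \<Omega>"
  shows "test_function \<Omega> (box_bump k a b)"
  unfolding test_function_def compact_eq_bounded_closed
  using assms box_bump_support[of k a b] bounded_subset[OF bounded_box box_bump_support]
  by (blast intro: smooth_box_bump)

lemma box_bump_tendsto_indicator: "(\<lambda>k. box_bump k a b x) \<longlonglongrightarrow> indicator (box a b) x"
proof -
  have "(\<lambda>k. box_bump k a b x) \<longlonglongrightarrow>
      (\<Prod>i\<in>UNIV. (if x $ i - a $ i > 0 then 1 else 0) * (if b $ i - x $ i > 0 then 1 else 0))"
    unfolding box_bump_def by (intro tendsto_intros flat_exp_0_tendsto_indicator)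
  also have "(\<Prod>i\<in>UNIV. (if x $ i - a $ i > 0 then 1 else 0) * (if b $ i - x $ i > 0 then 1 else 0))
      = (indicator (box a b) x :: real)"
  proof (cases "x \<in> box a b")
    case True
    then show ?thesis by (simp add: mem_box_cart)
  next
    case False
    then obtain i where "\<not> (a $ i < x $ i \<and> x $ i < b $ i)" by (auto simp: mem_box_cart)
    then have "(if x $ i - a $ i > 0 then 1 else 0) * (if b $ i - x $ i > 0 then 1 else 0) = (0::real)"
      by auto
    then have "(\<Prod>i\<in>UNIV. (if x $ i - a $ i > 0 then 1 else 0) * (if b $ i - x $ i > 0 then 1 else 0)) = (0::real)"
      by (intro prod_zero finite bexI[of _ i] UNIV_I)
    then show ?thesis unfolding indicator_simps(2)[OF False] .
  qed
  finally show ?thesis .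
qed

text \<open>The complement of the closed support is open and \<open>\<phi>\<close> is 0 on it, so
  the derivative vanishes there too. Test functions can therefore be differentiated
  repeatedly.\<close>

lemma closure_support_partial_deriv:
  "closure {x. partial_deriv i \<phi> x \<noteq> 0} \<subseteq> closure {x. \<phi> x \<noteq> 0}"
proof (rule closure_minimal[OF _ closed_closure], clarify, rule ccontr)
  let ?U = "- closure {x. \<phi> x \<noteq> 0}"
  fix x assume x: "partial_deriv i \<phi> x \<noteq> 0" "x \<notin> closure {x. \<phi> x \<noteq> 0}"
  have zero: "0 = \<phi> y" if "y \<in> ?U" for y
  proof -
    have "y \<notin> {x. \<phi> x \<noteq> 0}"
      using that closure_subset[of "{x. \<phi> x \<noteq> 0}"] by blast
    then show ?thesis by simp
  qed
  have "(\<phi> has_derivative (\<lambda>h. 0)) (at x)"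
    using x(2) by (intro has_derivative_transform_within_open[OF has_derivative_const, of ?U])
      (auto intro: zero)
  with x(1) show False using partial_deriv_eq by metis
qed

lemma test_function_partial_deriv:
  assumes "test_function \<Omega> \<phi>"
  shows "test_function \<Omega> (partial_deriv i \<phi>)"
  using assms closure_support_partial_deriv[of i \<phi>] bounded_subset
  unfolding test_function_def compact_eq_bounded_closed
  by (blast intro: smooth_partial_deriv)

section \<open>Weak derivatives\<close>

lemma abs_l2_add:
  assumes "square_integrable f" "square_integrable g"
  shows "abs_l2 (\<lambda>x. f x + g x) = abs_l2 f + abs_l2 g"
  using plus_l2.abs_eq[of f g] assms by (simp add: l2_eq_def)

lemma abs_l2_scale:
  assumes "square_integrable f"
  shows "abs_l2 (\<lambda>x. r * f x) = r *\<^sub>R abs_l2 f"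
  using scaleR_l2.abs_eq[of f r] assms by (simp add: l2_eq_def)

text \<open>\<open>rep_l2\<close> selects a representative of each class separately, so algebraic
  identities between representatives are available only almost everywhere.\<close>

lemma AE_rep_l2_add: "AE x in lborel. rep_l2 (f + g) x = rep_l2 f x + rep_l2 g x"
  using AE_rep_abs_l2[OF square_integrable_add[OF square_integrable_rep_l2[of f] square_integrable_rep_l2[of g]]]
  by (simp add: abs_l2_add square_integrable_rep_l2 abs_rep_l2)

lemma AE_rep_l2_scale: "AE x in lborel. rep_l2 (r *\<^sub>R f) x = r * rep_l2 f x"
  using AE_rep_abs_l2[OF square_integrable_scale[OF square_integrable_rep_l2[of f], of r]]
  by (simp add: abs_l2_scale square_integrable_rep_l2 abs_rep_l2)

lemma AE_rep_l2_zero: "AE x in lborel. rep_l2 0 x = 0"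
  using AE_rep_abs_l2[OF square_integrable_zero] by (simp add: zero_l2_def)

text \<open>Turns integrals against test functions into inner products of classes, whose linearity
  carries no integrability side conditions.\<close>

lemma inner_abs_l2:
  assumes "square_integrable \<phi>"
  shows "inner f (abs_l2 \<phi>) = (\<integral>x. rep_l2 f x * \<phi> x \<partial>lborel)"
  using inner_l2.abs_eq[of "rep_l2 f" \<phi>] assms
  by (simp add: l2_eq_def square_integrable_rep_l2 abs_rep_l2)

lemma subspace_L2: "subspace (L2 \<Omega>)"
proof (rule subspaceI)
  show "0 \<in> L2 \<Omega>"
    using AE_rep_l2_zero by (auto simp: L2_def elim: eventually_mono)
  show "f + g \<in> L2 \<Omega>" if "f \<in> L2 \<Omega>" "g \<in> L2 \<Omega>" for f g
    using that AE_rep_l2_add[of f g] unfolding L2_def mem_Collect_eq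
    by eventually_elim simp
  show "r *\<^sub>R f \<in> L2 \<Omega>" if "f \<in> L2 \<Omega>" for r f
    using that AE_rep_l2_scale[of r f] unfolding L2_def mem_Collect_eq
    by eventually_elim simp
qed

lemma square_integrable_bounded:
  fixes \<phi> :: "'a::euclidean_space \<Rightarrow> real"
  assumes "\<phi> \<in> borel_measurable borel" "K \<in> sets borel" "bounded K"
    and bound: "\<And>x. x \<in> K \<Longrightarrow> \<bar>\<phi> x\<bar> \<le> C" and zero: "\<And>x. x \<notin> K \<Longrightarrow> \<phi> x = 0"
  shows "square_integrable \<phi>"
  unfolding square_integrable_def
proof
  show "\<phi> \<in> borel_measurable lborel" using assms by simp
  show "integrable lborel (\<lambda>x. (\<phi> x)\<^sup>2)"
  proof (rule Bochner_Integration.integrable_bound)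
    show "integrable lborel (\<lambda>x. C\<^sup>2 * indicator K x)"
      using assms emeasure_bounded_finite[of K]
      by (intro integrable_mult_right integrable_real_indicator) auto
    show "(\<lambda>x. (\<phi> x)\<^sup>2) \<in> borel_measurable lborel" using assms(1) by simp
    have "norm ((\<phi> x)\<^sup>2) \<le> norm (C\<^sup>2 * indicator K x :: real)" for x
    proof (cases "x \<in> K")
      case True
      then show ?thesis
        using power_mono[OF bound[OF True], of 2] by simp
    qed (simp add: zero)
    then show "AE x in lborel. norm ((\<phi> x)\<^sup>2) \<le> norm (C\<^sup>2 * indicator K x :: real)" by simp
  qed
qed

text \<open>Boundedness of \<open>\<Omega>\<close> enters here: a function smooth on the whole space
  is bounded on the compact closure. This makes \<open>restrict_l2\<close> additive and homogeneous
  on smooth functions.\<close>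

lemma square_integrable_restrict_smooth:
  fixes \<phi> :: "real^'n::finite \<Rightarrow> real"
  assumes "smooth \<phi>" "open \<Omega>" "bounded \<Omega>"
  shows "square_integrable (\<lambda>x. indicator \<Omega> x * \<phi> x)"
proof -
  have "compact (\<phi> ` closure \<Omega>)"
    using assms by (intro compact_continuous_image smooth_continuous_on) auto
  then obtain C where C: "\<And>x. x \<in> closure \<Omega> \<Longrightarrow> \<bar>\<phi> x\<bar> \<le> C"
    using compact_imp_bounded bounded_iff[of "\<phi> ` closure \<Omega>"] by auto
  show ?thesis
  proof (rule square_integrable_bounded[of _ \<Omega> C])
    show "(\<lambda>x. indicator \<Omega> x * \<phi> x) \<in> borel_measurable borel"
      using assms by (intro borel_measurable_times borel_measurable_indicator smooth_borel_measurable) auto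
    show "\<bar>indicator \<Omega> x * \<phi> x\<bar> \<le> C" if "x \<in> \<Omega>" for x
      using that C closure_subset by auto
  qed (use assms in auto)
qed

lemma square_integrable_test_function:
  fixes \<phi> :: "real^'n::finite \<Rightarrow> real"
  assumes "test_function \<Omega> \<phi>"
  shows "square_integrable \<phi>"
proof -
  let ?K = "closure {x. \<phi> x \<noteq> 0}"
  have \<phi>: "smooth \<phi>" and K: "compact ?K" using assms by (auto simp: test_function_def)
  have "compact (\<phi> ` ?K)"
    using \<phi> K by (intro compact_continuous_image smooth_continuous_on)
  then obtain C where C: "\<And>x. x \<in> ?K \<Longrightarrow> \<bar>\<phi> x\<bar> \<le> C"
    using compact_imp_bounded bounded_iff[of "\<phi> ` ?K"] by auto
  show ?thesis
  proof (rule square_integrable_bounded[OF smooth_borel_measurable[OF \<phi>] _ _ C])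
    show "\<phi> x = 0" if "x \<notin> ?K" for x
      using that closure_subset[of "{x. \<phi> x \<noteq> 0}"] by auto
  qed (use K compact_imp_bounded in auto)
qed

section \<open>Test functions separate square-integrable classes\<close>

lemma integral_box_eq_0:
  fixes g :: "(real^'n::finite) l2"
  assumes box: "box a b \<subseteq> \<Omega>"
    and test: "\<And>\<phi>. test_function \<Omega> \<phi> \<Longrightarrow> (\<integral>x. rep_l2 g x * \<phi> x \<partial>lborel) = 0"
  shows "(\<integral>x. rep_l2 g x * indicator (box a b) x \<partial>lborel) = 0"
proof -
  note [measurable] = square_integrable_measurable[OF square_integrable_rep_l2]
    smooth_borel_measurable[OF smooth_box_bump]
  have int: "integrable lborel (\<lambda>x. rep_l2 g x * indicator (box a b) x)"
    by (intro integrable_mult_square_integrable square_integrable_rep_l2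
        square_integrable_bounded[of _ "box a b" 1]) auto
  \<comment> \<open>The indicator of a box is not smooth, but the bumps tend to it pointwise, lie
    between 0 and 1 and vanish off the box, so dominated convergence transfers the
    hypothesis.\<close>
  have "(\<lambda>k. \<integral>x. rep_l2 g x * box_bump k a b x \<partial>lborel) \<longlonglongrightarrow>
      (\<integral>x. rep_l2 g x * indicator (box a b) x \<partial>lborel)"
  proof (rule integral_dominated_convergence)
    show "integrable lborel (\<lambda>x. \<bar>rep_l2 g x * indicator (box a b) x\<bar>)"
      using int by simp
    show "AE x in lborel. (\<lambda>k. rep_l2 g x * box_bump k a b x) \<longlonglongrightarrow> rep_l2 g x * indicator (box a b) x"
      by (intro always_eventually allI tendsto_mult tendsto_const box_bump_tendsto_indicator)
    have "norm (rep_l2 g x * box_bump k a b x) \<le> \<bar>rep_l2 g x * indicator (box a b) x\<bar>" for k x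
    proof (cases "x \<in> box a b")
      case True
      then show ?thesis
        using box_bump_bounds[of k a b x] by (simp add: abs_mult mult_left_le)
    next
      case False
      then have "box_bump k a b x = 0"
        using box_bump_support[of k a b] closure_subset[of "{x. box_bump k a b x \<noteq> 0}"] by blast
      then show ?thesis by simp
    qed
    then show "AE x in lborel. norm (rep_l2 g x * box_bump k a b x) \<le> \<bar>rep_l2 g x * indicator (box a b) x\<bar>" for k
      by simp
  qed (measurable)
  then have "(\<lambda>k. 0) \<longlonglongrightarrow> (\<integral>x. rep_l2 g x * indicator (box a b) x \<partial>lborel)"
    unfolding test[OF test_function_box_bump[OF box]] .
  then show ?thesis by (rule LIMSEQ_unique[OF _ tendsto_const])
qed

text \<open>A Dynkin argument for a signed integrand: the Borel sets over which \<open>h\<close>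
  integrates to 0 are closed under complements, thanks to \<open>univ\<close>, and under countable
  disjoint unions, while the boxes form an intersection-stable generator. So \<open>h\<close> and 0
  have equal integrals over all Borel sets.\<close>

lemma AE_eq_0_if_integral_box_eq_0:
  fixes h :: "'a::euclidean_space \<Rightarrow> real"
  assumes int: "integrable lborel h"
    and univ: "(\<integral>x. h x \<partial>lborel) = 0"
    and box: "\<And>a b. (\<integral>x\<in>box a b. h x \<partial>lborel) = 0"
  shows "AE x in lborel. h x = 0"
proof (rule density_unique_real[OF int])
  let ?G = "range (\<lambda>(a, b). box a b :: 'a set)"
  have set_int: "set_integrable lborel A h" if "A \<in> sets borel" for A
    unfolding set_integrable_def using that int by (intro integrable_mult_indicator) auto
  have sets: "sets borel = sigma_sets UNIV ?G" by (simp add: borel_eq_box)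
  have "(\<integral>x\<in>A. h x \<partial>lborel) = 0" if "A \<in> sigma_sets UNIV ?G" for A
  proof (rule sigma_sets_induct_disjoint[OF _ _ that])
    show "Int_stable ?G" by (auto simp: Int_stable_def box_Int_box)
    show "(\<integral>x\<in>A. h x \<partial>lborel) = 0" if "A \<in> ?G" for A
      using that box by auto
    show "(\<integral>x\<in>UNIV - A. h x \<partial>lborel) = 0"
      if "A \<in> sigma_sets UNIV ?G" and "(\<integral>x\<in>A. h x \<partial>lborel) = 0" for A
    proof -
      have "A \<in> sets borel" using that sets by simp
      then have "(\<integral>x\<in>(UNIV - A) \<union> A. h x \<partial>lborel) = (\<integral>x\<in>UNIV - A. h x \<partial>lborel) + (\<integral>x\<in>A. h x \<partial>lborel)"
        by (intro set_integral_Un set_int) auto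
      then show ?thesis using that univ by (simp add: set_lebesgue_integral_def)
    qed
    show "(\<integral>x\<in>(\<Union>i. A i). h x \<partial>lborel) = 0"
      if "disjoint_family A" "range A \<subseteq> sigma_sets UNIV ?G" "\<And>i::nat. (\<integral>x\<in>A i. h x \<partial>lborel) = 0" for A
    proof -
      have A: "A i \<in> sets borel" for i using that(2) sets by auto
      then have "(\<integral>x\<in>(\<Union>i. A i). h x \<partial>lborel) = (\<Sum>i. (\<integral>x\<in>A i. h x \<partial>lborel))"
        using that(1)
        by (intro lebesgue_integral_countable_add set_int) (auto simp: disjoint_family_on_def)
      then show ?thesis using that(3) by simp
    qed
  qed (auto simp: set_lebesgue_integral_def)
  then show "(\<integral>x\<in>A. h x \<partial>lborel) = (\<integral>x\<in>A. 0 \<partial>lborel)" if "A \<in> sets lborel" for A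
    using that sets by simp
qed simp

text \<open>The fundamental lemma of the calculus of variations. Membership in
  \<open>L2 \<Omega>\<close> settles the points outside \<open>\<Omega>\<close>; inside, the claim
  is localised to boxes.\<close>

lemma L2_eq_0_if_orthogonal_test_functions:
  fixes g :: "(real^'n::finite) l2"
  assumes "open \<Omega>" "g \<in> L2 \<Omega>"
    and test: "\<And>\<phi>. test_function \<Omega> \<phi> \<Longrightarrow> inner g (abs_l2 \<phi>) = 0"
  shows "g = 0"
proof -
  have test': "(\<integral>x. rep_l2 g x * \<phi> x \<partial>lborel) = 0" if "test_function \<Omega> \<phi>" for \<phi>
    using test[OF that] by (simp add: inner_abs_l2 square_integrable_test_function[OF that])
  \<comment> \<open>Cutting off by a box makes the integrand integrable, which \<open>g\<close>,
    being only square integrable, need not be.\<close>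
  have AE_box: "AE x in lborel. x \<in> box a b \<longrightarrow> rep_l2 g x = 0" if ab: "box a b \<subseteq> \<Omega>" for a b
  proof -
    have "AE x in lborel. rep_l2 g x * indicator (box a b) x = 0"
    proof (rule AE_eq_0_if_integral_box_eq_0)
      show "integrable lborel (\<lambda>x. rep_l2 g x * indicator (box a b) x)"
        by (intro integrable_mult_square_integrable square_integrable_rep_l2
            square_integrable_bounded[of _ "box a b" 1]) auto
      show "(\<integral>x. rep_l2 g x * indicator (box a b) x \<partial>lborel) = 0"
        by (rule integral_box_eq_0[OF ab test'])
      show "(\<integral>x\<in>box c d. rep_l2 g x * indicator (box a b) x \<partial>lborel) = 0" for c d
      proof -
        \<comment> \<open>The intersection is again a box inside \<open>\<Omega>\<close>, so the
          vanishing of box integrals applies to it.\<close>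
        obtain p q where pq: "box a b \<inter> box c d = box p q"
          by (rule that[OF box_Int_box])
        have "(\<integral>x\<in>box c d. rep_l2 g x * indicator (box a b) x \<partial>lborel)
            = (\<integral>x. rep_l2 g x * indicator (box p q) x \<partial>lborel)"
          unfolding pq[symmetric] set_lebesgue_integral_def indicator_inter_arith
          by (simp add: mult_ac)
        also have "\<dots> = 0"
          using ab pq by (intro integral_box_eq_0[OF _ test']) auto
        finally show ?thesis .
      qed
    qed
    then show ?thesis by eventually_elim auto
  qed
  \<comment> \<open>Boxes with rational corners: countably many of them fill
    \<open>\<Omega>\<close>, so the exceptional null sets unite to a null set.\<close>
  define I where "I = {f \<in> Basis \<rightarrow>\<^sub>E \<rat> \<times> \<rat>. box (\<Sum>i\<in>Basis. fst (f i :: real \<times> real) *\<^sub>R i)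
      (\<Sum>i\<in>Basis. snd (f i) *\<^sub>R (i :: real^'n)) \<subseteq> \<Omega>}"
  have \<Omega>: "\<Omega> = (\<Union>f\<in>I. box (\<Sum>i\<in>Basis. fst (f i) *\<^sub>R i) (\<Sum>i\<in>Basis. snd (f i) *\<^sub>R i))"
    unfolding I_def by (rule open_UNION_box[OF \<open>open \<Omega>\<close>])
  have "countable I" unfolding I_def
    by (rule countable_subset[of _ "Basis \<rightarrow>\<^sub>E \<rat> \<times> \<rat>"])
      (auto intro!: countable_PiE countable_SIGMA countable_rat)
  then have "AE x in lborel. \<forall>f\<in>I. x \<in> box (\<Sum>i\<in>Basis. fst (f i) *\<^sub>R i) (\<Sum>i\<in>Basis. snd (f i) *\<^sub>R i)
      \<longrightarrow> rep_l2 g x = 0"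
    unfolding AE_ball_countable[OF \<open>countable I\<close>] by (auto simp: I_def intro!: AE_box)
  moreover have "AE x in lborel. x \<notin> \<Omega> \<longrightarrow> rep_l2 g x = 0"
    using assms(2) by (simp add: L2_def)
  ultimately have "AE x in lborel. rep_l2 g x = rep_l2 0 x"
    using AE_rep_l2_zero
  proof eventually_elim
    case (elim x)
    have "rep_l2 g x = 0"
    proof (cases "x \<in> \<Omega>")
      case True
      with \<Omega> show ?thesis using elim(1) by blast
    qed (use elim(2) in blast)
    with elim(3) show ?case by simp
  qed
  then show ?thesis by (simp add: l2_eq_iff_AE)
qed

lemma L2_eqI:
  fixes f g :: "(real^'n::finite) l2"
  assumes "open \<Omega>" "f \<in> L2 \<Omega>" "g \<in> L2 \<Omega>"
    and "\<And>\<phi>. test_function \<Omega> \<phi> \<Longrightarrow> inner f (abs_l2 \<phi>) = inner g (abs_l2 \<phi>)"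
  shows "f = g"
  using L2_eq_0_if_orthogonal_test_functions[OF assms(1) subspace_diff[OF subspace_L2 assms(2,3)]] assms(4)
  by (simp add: inner_diff_left)

lemma inner_abs_l2_test_function:
  assumes "test_function \<Omega> \<phi>"
  shows "inner f (abs_l2 \<phi>) = (\<integral>x. rep_l2 f x * \<phi> x \<partial>lborel)"
    and "inner f (abs_l2 (partial_deriv i \<phi>)) = (\<integral>x. rep_l2 f x * partial_deriv i \<phi> x \<partial>lborel)"
  using assms test_function_partial_deriv[OF assms]
  by (simp_all add: inner_abs_l2 square_integrable_test_function[of \<Omega>])

section \<open>Weak partial derivatives and gradients\<close>

lemma has_weak_pderiv_iff:
  "has_weak_pderiv \<Omega> i f g \<longleftrightarrow> g \<in> L2 \<Omega> \<and> (\<forall>\<phi>. test_function \<Omega> \<phi> \<longrightarrow>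
    inner f (abs_l2 (partial_deriv i \<phi>)) = - inner g (abs_l2 \<phi>))"
  unfolding has_weak_pderiv_def by (simp add: inner_abs_l2_test_function[of \<Omega>])

lemma has_weak_rot_iff:
  "has_weak_rot \<Omega> i j \<theta> \<kappa> \<longleftrightarrow> \<kappa> \<in> L2 \<Omega> \<and> (\<forall>\<phi>. test_function \<Omega> \<phi> \<longrightarrow>
    inner (\<theta> $ j) (abs_l2 (partial_deriv i \<phi>)) - inner (\<theta> $ i) (abs_l2 (partial_deriv j \<phi>))
      = - inner \<kappa> (abs_l2 \<phi>))"
proof -
  \<comment> \<open>Splitting the integral of the difference requires each product to be integrable
    on its own.\<close>
  have "integrable lborel (\<lambda>x. rep_l2 f x * partial_deriv k \<phi> x)" if "test_function \<Omega> \<phi>" for f k \<phi>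
    by (intro integrable_mult_square_integrable square_integrable_rep_l2
        square_integrable_test_function[of \<Omega>] test_function_partial_deriv that)
  then show ?thesis
    unfolding has_weak_rot_def by (simp add: inner_abs_l2_test_function[of \<Omega>])
qed

text \<open>Both candidates lie in \<open>L2 \<Omega>\<close>, where test functions determine the
  class; this gives the definite description in \<open>weak_pderiv\<close> its meaning.\<close>

lemma has_weak_pderiv_unique:
  "open \<Omega> \<Longrightarrow> has_weak_pderiv \<Omega> i f g \<Longrightarrow> has_weak_pderiv \<Omega> i f g' \<Longrightarrow> g = g'"
  unfolding has_weak_pderiv_iff by (rule L2_eqI) auto

lemma weak_pderiv_eqI: "open \<Omega> \<Longrightarrow> has_weak_pderiv \<Omega> i f g \<Longrightarrow> weak_pderiv \<Omega> i f = g"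
  unfolding weak_pderiv_def by (blast intro: has_weak_pderiv_unique)

lemma H1_has_weak_pderiv:
  "open \<Omega> \<Longrightarrow> f \<in> H1 \<Omega> \<Longrightarrow> has_weak_pderiv \<Omega> i f (weak_pderiv \<Omega> i f)"
  using weak_pderiv_eqI unfolding H1_def by blast

lemma has_weak_pderiv_zero: "has_weak_pderiv \<Omega> i 0 0"
  by (simp add: has_weak_pderiv_iff subspace_0[OF subspace_L2])

lemma has_weak_pderiv_add:
  "has_weak_pderiv \<Omega> i f g \<Longrightarrow> has_weak_pderiv \<Omega> i f' g' \<Longrightarrow> has_weak_pderiv \<Omega> i (f + f') (g + g')"
  by (simp add: has_weak_pderiv_iff subspace_add[OF subspace_L2] inner_add_left)

lemma has_weak_pderiv_scale:
  "has_weak_pderiv \<Omega> i f g \<Longrightarrow> has_weak_pderiv \<Omega> i (r *\<^sub>R f) (r *\<^sub>R g)"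
  by (simp add: has_weak_pderiv_iff subspace_scale[OF subspace_L2])

lemma subspace_H1: "subspace (H1 \<Omega>)"
  unfolding H1_def
  by (rule subspaceI)
    (auto intro: subspace_0[OF subspace_L2] subspace_add[OF subspace_L2] subspace_scale[OF subspace_L2],
      (blast intro: has_weak_pderiv_zero has_weak_pderiv_add has_weak_pderiv_scale)+)

lemma weak_pderiv_zero: "open \<Omega> \<Longrightarrow> weak_pderiv \<Omega> i 0 = 0"
  by (intro weak_pderiv_eqI has_weak_pderiv_zero)

lemma weak_pderiv_add:
  "open \<Omega> \<Longrightarrow> f \<in> H1 \<Omega> \<Longrightarrow> g \<in> H1 \<Omega> \<Longrightarrow>
    weak_pderiv \<Omega> i (f + g) = weak_pderiv \<Omega> i f + weak_pderiv \<Omega> i g"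
  by (intro weak_pderiv_eqI has_weak_pderiv_add H1_has_weak_pderiv)

lemma weak_pderiv_scale:
  "open \<Omega> \<Longrightarrow> f \<in> H1 \<Omega> \<Longrightarrow> weak_pderiv \<Omega> i (r *\<^sub>R f) = r *\<^sub>R weak_pderiv \<Omega> i f"
  by (intro weak_pderiv_eqI has_weak_pderiv_scale H1_has_weak_pderiv)

lemma weak_grad_add:
  "open \<Omega> \<Longrightarrow> f \<in> H1 \<Omega> \<Longrightarrow> g \<in> H1 \<Omega> \<Longrightarrow> weak_grad \<Omega> (f + g) = weak_grad \<Omega> f + weak_grad \<Omega> g"
  by (simp add: weak_grad_def vec_eq_iff weak_pderiv_add)

lemma weak_grad_scale:
  "open \<Omega> \<Longrightarrow> f \<in> H1 \<Omega> \<Longrightarrow> weak_grad \<Omega> (r *\<^sub>R f) = r *\<^sub>R weak_grad \<Omega> f"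
  by (simp add: weak_grad_def vec_eq_iff weak_pderiv_scale)

lemma weak_grad_zero: "open \<Omega> \<Longrightarrow> weak_grad \<Omega> 0 = 0"
  by (simp add: weak_grad_def vec_eq_iff weak_pderiv_zero)

section \<open>Weak rotation\<close>

lemma has_weak_rot_unique:
  "open \<Omega> \<Longrightarrow> has_weak_rot \<Omega> i j \<theta> \<kappa> \<Longrightarrow> has_weak_rot \<Omega> i j \<theta> \<kappa>' \<Longrightarrow> \<kappa> = \<kappa>'"
  unfolding has_weak_rot_iff by (rule L2_eqI) auto

lemma weak_rot_eqI: "open \<Omega> \<Longrightarrow> has_weak_rot \<Omega> i j \<theta> \<kappa> \<Longrightarrow> weak_rot \<Omega> i j \<theta> = \<kappa>"
  unfolding weak_rot_def by (blast intro: has_weak_rot_unique)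

lemma has_weak_rot_add:
  "has_weak_rot \<Omega> i j \<theta> \<kappa> \<Longrightarrow> has_weak_rot \<Omega> i j \<eta> \<mu> \<Longrightarrow> has_weak_rot \<Omega> i j (\<theta> + \<eta>) (\<kappa> + \<mu>)"
  unfolding has_weak_rot_iff
  by (simp add: subspace_add[OF subspace_L2] inner_add_left add_diff_add)

lemma has_weak_rot_scale:
  "has_weak_rot \<Omega> i j \<theta> \<kappa> \<Longrightarrow> has_weak_rot \<Omega> i j (r *\<^sub>R \<theta>) (r *\<^sub>R \<kappa>)"
  by (simp add: has_weak_rot_iff subspace_scale[OF subspace_L2] flip: right_diff_distrib)

text \<open>As \<open>v\<close> is only in \<open>H1 \<Omega>\<close>, both derivatives are moved
  onto the test function, whose mixed derivatives commute.\<close>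

lemma has_weak_rot_weak_grad:
  assumes "open \<Omega>" "v \<in> H1 \<Omega>"
  shows "has_weak_rot \<Omega> i j (weak_grad \<Omega> v) 0"
proof -
  have "inner (weak_pderiv \<Omega> k v) (abs_l2 (partial_deriv l \<phi>))
      = - inner v (abs_l2 (partial_deriv k (partial_deriv l \<phi>)))" if "test_function \<Omega> \<phi>" for k l \<phi>
    using H1_has_weak_pderiv[OF assms, of k] test_function_partial_deriv[OF that, of l]
    by (simp add: has_weak_pderiv_iff)
  moreover have "partial_deriv i (partial_deriv j \<phi>) = partial_deriv j (partial_deriv i \<phi>)"
    if "test_function \<Omega> \<phi>" for \<phi>
    using that by (intro ext partial_deriv_commute) (simp add: test_function_def)
  ultimately show ?thesis
    by (simp add: has_weak_rot_iff weak_grad_def subspace_0[OF subspace_L2])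
qed

lemma has_weak_rot_H1_vec:
  assumes "open \<Omega>" "\<psi> \<in> H1_vec \<Omega>"
  shows "has_weak_rot \<Omega> i j \<psi> (weak_pderiv \<Omega> i (\<psi> $ j) - weak_pderiv \<Omega> j (\<psi> $ i))"
proof -
  have "has_weak_pderiv \<Omega> k (\<psi> $ l) (weak_pderiv \<Omega> k (\<psi> $ l))" for k l
    using assms by (intro H1_has_weak_pderiv) (auto simp: H1_vec_def)
  then show ?thesis
    by (simp add: has_weak_rot_iff has_weak_pderiv_iff subspace_diff[OF subspace_L2] inner_diff_left)
qed

text \<open>The domain on which the definite description in \<open>weak_rot\<close> denotes and is
  therefore linear. Asking for all index pairs at once serves the curl in both dimensions.\<close>

definition H_rot :: "(real^'n::finite) set \<Rightarrow> ((real^'n) l2 ^ 'n) set" where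
  "H_rot \<Omega> = {\<theta>. \<forall>i j. \<exists>\<kappa>. has_weak_rot \<Omega> i j \<theta> \<kappa>}"

lemma H_rot_has_weak_rot:
  "open \<Omega> \<Longrightarrow> \<theta> \<in> H_rot \<Omega> \<Longrightarrow> has_weak_rot \<Omega> i j \<theta> (weak_rot \<Omega> i j \<theta>)"
  using weak_rot_eqI unfolding H_rot_def by blast

text \<open>The gradient has rotation 0 and the field in \<open>H1_vec \<Omega>\<close> has one
  built from its weak derivatives; subtraction is addition of the multiple by -1.\<close>

lemma Xi_in_H_rot:
  assumes "open \<Omega>" "v \<in> H1 \<Omega>" "\<psi> \<in> H1_vec \<Omega>"
  shows "Xi \<Omega> (v, \<psi>) \<in> H_rot \<Omega>"
  using has_weak_rot_add[OF has_weak_rot_weak_grad[OF assms(1,2)]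
      has_weak_rot_scale[OF has_weak_rot_H1_vec[OF assms(1,3)], of _ _ "- 1"]]
  by (auto simp: H_rot_def Xi_def)

lemma weak_rot_add:
  "open \<Omega> \<Longrightarrow> \<theta> \<in> H_rot \<Omega> \<Longrightarrow> \<eta> \<in> H_rot \<Omega> \<Longrightarrow>
    weak_rot \<Omega> i j (\<theta> + \<eta>) = weak_rot \<Omega> i j \<theta> + weak_rot \<Omega> i j \<eta>"
  by (intro weak_rot_eqI has_weak_rot_add H_rot_has_weak_rot)

lemma weak_rot_scale:
  "open \<Omega> \<Longrightarrow> \<theta> \<in> H_rot \<Omega> \<Longrightarrow> weak_rot \<Omega> i j (r *\<^sub>R \<theta>) = r *\<^sub>R weak_rot \<Omega> i j \<theta>"
  by (intro weak_rot_eqI has_weak_rot_scale H_rot_has_weak_rot)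

section \<open>The curl inner product\<close>

lemma inner_curl_commute: "inner_curl \<Omega> e \<theta> \<eta> = inner_curl \<Omega> e \<eta> \<theta>"
  by (simp add: inner_curl_def inner_commute)

text \<open>The curl term is a square, so definiteness is inherited from the \<open>L2\<close> part,
  for every field.\<close>

lemma inner_curl_self_ge: "inner \<theta> \<theta> \<le> inner_curl \<Omega> e \<theta> \<theta>"
  by (simp add: inner_curl_def)

lemma inner_curl_self_eq_0: "inner_curl \<Omega> e \<theta> \<theta> = 0 \<Longrightarrow> \<theta> = 0"
  using inner_curl_self_ge[of \<theta> \<Omega> e] inner_ge_zero[of \<theta>] by (metis antisym inner_eq_zero_iff)

lemma inner_curl_add_left:
  fixes \<Omega> :: "(real^'n::finite) set"
  assumes "open \<Omega>" "\<theta> \<in> H_rot \<Omega>" "\<eta> \<in> H_rot \<Omega>"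
  shows "inner_curl \<Omega> e (\<theta> + \<eta>) \<zeta> = inner_curl \<Omega> e \<theta> \<zeta> + inner_curl \<Omega> e \<eta> \<zeta>"
  using assms
  by (simp add: inner_curl_def curl2_def curl3_def weak_rot_add inner_vec_def[where ?'b = 3] sum_3 inner_add_left)

lemma inner_curl_scale_left:
  fixes \<Omega> :: "(real^'n::finite) set"
  assumes "open \<Omega>" "\<theta> \<in> H_rot \<Omega>"
  shows "inner_curl \<Omega> e (r *\<^sub>R \<theta>) \<zeta> = r * inner_curl \<Omega> e \<theta> \<zeta>"
  using assms
  by (simp add: inner_curl_def curl2_def curl3_def weak_rot_scale inner_vec_def[where ?'b = 3] sum_3 algebra_simps)

lemma bilinear_form_on_inner_curl:
  assumes "open \<Omega>" "Q \<subseteq> H_rot \<Omega>"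
  shows "bilinear_form_on Q (inner_curl \<Omega> e)"
  unfolding bilinear_form_on_def linear_form_on_def
  using inner_curl_add_left[OF assms(1)] inner_curl_scale_left[OF assms(1)] assms(2)
  by (simp add: inner_curl_commute[of _ _ _ "_ + _"] inner_curl_commute[of _ _ _ "_ *\<^sub>R _"] subset_iff)
    (simp add: inner_curl_commute)

section \<open>Finite-dimensional bilinear problems\<close>

lemma linear_form_on_uminus:
  assumes "linear_form_on V F" "x \<in> V"
  shows "F (- x) = - F x"
  using assms unfolding linear_form_on_def by (metis scaleR_minus1_left mult_minus1)

lemma linear_form_on_diff:
  assumes "linear_form_on V F" "subspace V" "x \<in> V" "y \<in> V"
  shows "F (x - y) = F x - F y"
proof -
  have "F (x + - y) = F x + F (- y)"
    using assms subspace_neg unfolding linear_form_on_def by blast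
  then show ?thesis using linear_form_on_uminus[OF assms(1,4)] by simp
qed

lemma linear_form_on_zero:
  assumes "linear_form_on V F" "subspace V"
  shows "F 0 = 0"
  using linear_form_on_diff[OF assms subspace_0[OF assms(2)] subspace_0[OF assms(2)]] by simp

lemma linear_form_on_sum:
  assumes "linear_form_on V F" "subspace V" "finite I" "\<And>i. i \<in> I \<Longrightarrow> x i \<in> V"
  shows "F (\<Sum>i\<in>I. r i *\<^sub>R x i) = (\<Sum>i\<in>I. r i * F (x i))"
  using assms(3,4)
proof (induction I rule: finite_induct)
  case empty
  then show ?case by (simp add: linear_form_on_zero[OF assms(1,2)])
next
  case (insert i I)
  have "r i *\<^sub>R x i \<in> V" "(\<Sum>i\<in>I. r i *\<^sub>R x i) \<in> V"
    using insert by (auto intro!: subspace_sum subspace_scale assms(2))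
  then have "F (r i *\<^sub>R x i + (\<Sum>i\<in>I. r i *\<^sub>R x i)) = r i * F (x i) + F (\<Sum>i\<in>I. r i *\<^sub>R x i)"
    using assms(1) insert unfolding linear_form_on_def by simp
  with insert show ?case by simp
qed

lemma linear_form_on_subset: "linear_form_on V F \<Longrightarrow> U \<subseteq> V \<Longrightarrow> linear_form_on U F"
  unfolding linear_form_on_def by blast

lemma bilinear_form_on_subset: "bilinear_form_on V b \<Longrightarrow> U \<subseteq> V \<Longrightarrow> bilinear_form_on U b"
  unfolding bilinear_form_on_def by (blast intro: linear_form_on_subset)

lemma linear_form_on_span_eq:
  assumes "linear_form_on V F" "linear_form_on V F'" "subspace V" "finite S" "V = span S"
    and "\<And>x. x \<in> S \<Longrightarrow> F x = F' x" and "x \<in> V"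
  shows "F x = F' x"
proof -
  obtain r where x: "x = (\<Sum>s\<in>S. r s *\<^sub>R s)"
    using assms(7) unfolding assms(5) span_finite[OF assms(4)] by blast
  have S: "S \<subseteq> V" using assms(5) span_superset by auto
  then have "F x = (\<Sum>s\<in>S. r s * F s)" "F' x = (\<Sum>s\<in>S. r s * F' s)"
    unfolding x
    using linear_form_on_sum[OF assms(1,3,4), of "\<lambda>s. s" r]
      linear_form_on_sum[OF assms(2,3,4), of "\<lambda>s. s" r] by blast+
  then show ?thesis using assms(6) by simp
qed

lemma linear_inj_on_span_imp_surj:
  fixes g :: "'v::real_vector \<Rightarrow> 'v"
  assumes "linear g" "finite S" "independent S" "g ` S \<subseteq> span S" "inj_on g (span S)"
  shows "g ` span S = span S"
proof
  show "g ` span S \<subseteq> span S"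
    using assms(1,4) by (metis linear_span_image span_minimal subspace_span)
  show "span S \<subseteq> g ` span S"
  proof (rule ccontr)
    assume "\<not> span S \<subseteq> g ` span S"
    then obtain y where y: "y \<in> span S" "y \<notin> span (g ` S)"
      using linear_span_image[OF assms(1), of S] by auto
    have "independent (g ` S)"
      using assms by (intro linear_independent_injective_image)
    then have "independent (insert y (g ` S))"
      using y(2) by (simp add: independent_insertI)
    then have "card (insert y (g ` S)) \<le> card S"
      using independent_span_bound[OF assms(2)] y(1) assms(4) by blast
    moreover have "card (g ` S) = card S"
      by (rule card_image[OF inj_on_subset[OF assms(5) span_superset]])
    moreover have "y \<notin> g ` S" using y(2) span_base[of y "g ` S"] by blast
    ultimately show False using assms(2) by simp
  qed
qed

text \<open>The values of a linear form on a basis of \<open>V\<close> are encoded as coefficients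
  of a vector of \<open>V\<close>. The form \<open>b\<close> then becomes an endomorphism of
  \<open>V\<close>, which nondegeneracy makes injective and the dimension count surjective; symmetry
  plays no part in this encoding.\<close>

lemma ex1_bilinear_form_on:
  fixes V :: "'v::real_vector set"
  assumes b: "bilinear_form_on V b" and V: "subspace V" and fin: "finite S" "V \<subseteq> span S"
    and nondeg: "\<And>u. u \<in> V \<Longrightarrow> \<forall>v\<in>V. b u v = 0 \<Longrightarrow> u = 0"
    and l: "linear_form_on V l"
  shows "\<exists>!u. u \<in> V \<and> (\<forall>v\<in>V. b u v = l v)"
proof -
  \<comment> \<open>The set \<open>S\<close> may stick out of \<open>V\<close>; the construction
    needs a basis inside \<open>V\<close>.\<close>
  obtain S' where S': "S' \<subseteq> V" "independent S'" "V \<subseteq> span S'"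
    by (meson maximal_independent_subset)
  have V_eq: "V = span S'" using S' V by (simp add: span_minimal subset_antisym)
  have fin': "finite S'" using independent_span_bound[OF fin(1) S'(2)] S'(1) fin(2) by blast
  have lin1: "linear_form_on V (b u)" if "u \<in> V" for u
    using b that by (simp add: bilinear_form_on_def)
  have lin2: "linear_form_on V (\<lambda>u. b u v)" if "v \<in> V" for v
    using b that by (simp add: bilinear_form_on_def)
  define T where "T u = (\<Sum>v\<in>S'. b u v *\<^sub>R v)" for u
  \<comment> \<open>\<open>T\<close> is linear only on \<open>V\<close>, as \<open>b\<close> is
    bilinear only there; \<open>g\<close> is a linear map on the whole space that agrees with it on
    the basis.\<close>
  obtain g where g: "linear g" "\<And>x. x \<in> S' \<Longrightarrow> g x = T x"
    using linear_independent_extend[OF S'(2)] by metis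
  have g_T: "g u = T u" if uV: "u \<in> V" for u
  proof -
    obtain r where u: "u = (\<Sum>s\<in>S'. r s *\<^sub>R s)"
      using uV unfolding V_eq span_finite[OF fin'] by blast
    have "T u = (\<Sum>v\<in>S'. (\<Sum>s\<in>S'. r s * b s v) *\<^sub>R v)"
    proof -
      have "b u v = (\<Sum>s\<in>S'. r s * b s v)" if "v \<in> S'" for v
        unfolding u using S'(1) that by (intro linear_form_on_sum[OF lin2 V fin']) auto
      then show ?thesis by (simp add: T_def)
    qed
    also have "\<dots> = (\<Sum>s\<in>S'. r s *\<^sub>R T s)"
      unfolding T_def scaleR_sum_left scaleR_sum_right scaleR_scaleR by (rule sum.swap)
    also have "\<dots> = g u"
      unfolding u using g by (simp add: linear_sum linear_scale)
    finally show ?thesis by simp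
  qed
  \<comment> \<open>Independence of \<open>S'\<close> recovers the encoded values from the
    vector.\<close>
  have coeff: "p v = q v" if eq: "(\<Sum>v\<in>S'. p v *\<^sub>R v) = (\<Sum>v\<in>S'. q v *\<^sub>R v)" and v: "v \<in> S'"
    for p q v
  proof -
    have "(\<Sum>v\<in>S'. (p v - q v) *\<^sub>R v) = 0"
      using eq by (simp add: scaleR_diff_left sum_subtractf)
    from independentD[OF S'(2) fin' subset_refl this v] show ?thesis by simp
  qed
  have solution_iff: "(\<forall>v\<in>V. b u v = l v) \<longleftrightarrow> g u = (\<Sum>v\<in>S'. l v *\<^sub>R v)" if u: "u \<in> V" for u
  proof
    assume "\<forall>v\<in>V. b u v = l v"
    then show "g u = (\<Sum>v\<in>S'. l v *\<^sub>R v)"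
      unfolding g_T[OF u] T_def using S'(1) by (intro sum.cong) auto
  next
    assume "g u = (\<Sum>v\<in>S'. l v *\<^sub>R v)"
    then have "b u v = l v" if "v \<in> S'" for v
      using coeff[of "b u" l, OF _ that] unfolding g_T[OF u] T_def by blast
    then show "\<forall>v\<in>V. b u v = l v"
      using linear_form_on_span_eq[OF lin1[OF u] l V fin' V_eq] by blast
  qed
  have inj: "inj_on g V"
  proof (rule inj_onI)
    fix x y assume xy: "x \<in> V" "y \<in> V" "g x = g y"
    have xy': "x - y \<in> V" using xy V by (simp add: subspace_diff)
    have "g (x - y) = 0" using xy g(1) by (simp add: linear_diff)
    then have "(\<Sum>v\<in>S'. b (x - y) v *\<^sub>R v) = (\<Sum>v\<in>S'. 0 *\<^sub>R v)"
      using g_T[OF xy'] by (simp add: T_def)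
    then have "b (x - y) v = 0" if "v \<in> S'" for v
      by (rule coeff[of "b (x - y)" "\<lambda>v. 0", OF _ that])
    moreover have "linear_form_on V (\<lambda>v. 0)" by (simp add: linear_form_on_def)
    ultimately have "\<forall>v\<in>V. b (x - y) v = 0"
      using linear_form_on_span_eq[OF lin1[OF xy'] _ V fin' V_eq, of "\<lambda>v. 0"] by blast
    then show "x = y" using nondeg[OF xy'] by simp
  qed
  have "g ` V = V"
    unfolding V_eq
  proof (rule linear_inj_on_span_imp_surj[OF g(1) fin' S'(2)])
    show "g ` S' \<subseteq> span S'"
    proof clarify
      fix x assume "x \<in> S'"
      show "g x \<in> span S'"
        unfolding g(2)[OF \<open>x \<in> S'\<close>] T_def by (intro span_sum span_scale span_base)
    qed
  qed (use inj V_eq in simp)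
  moreover have "(\<Sum>v\<in>S'. l v *\<^sub>R v) \<in> V"
    using S'(1) by (auto intro!: subspace_sum subspace_scale V)
  ultimately have "(\<Sum>v\<in>S'. l v *\<^sub>R v) \<in> g ` V" by simp
  then obtain u where u: "u \<in> V" "g u = (\<Sum>v\<in>S'. l v *\<^sub>R v)" by (rule imageE) simp
  show ?thesis
  proof (rule ex1I[of _ u])
    show "u \<in> V \<and> (\<forall>v\<in>V. b u v = l v)" using u solution_iff by blast
    show "x = u" if "x \<in> V \<and> (\<forall>v\<in>V. b x v = l v)" for x
      by (rule inj_onD[OF inj]) (use that u solution_iff[of x] in simp_all)
  qed
qed

text \<open>The kernel condition makes \<open>L\<close> constant on the fibres of \<open>T\<close>,
  so evaluating it at an arbitrary preimage is well defined. It yields the right-hand side of the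
  equation for the multiplier.\<close>

lemma linear_form_on_factor:
  assumes V: "subspace V" and L: "linear_form_on V L"
    and add: "\<And>x y. x \<in> V \<Longrightarrow> y \<in> V \<Longrightarrow> T (x + y) = T x + T y"
    and scale: "\<And>r x. x \<in> V \<Longrightarrow> T (r *\<^sub>R x) = r *\<^sub>R T x"
    and ker: "\<And>x. x \<in> V \<Longrightarrow> T x = 0 \<Longrightarrow> L x = 0"
  obtains l where "linear_form_on (T ` V) l" "\<And>x. x \<in> V \<Longrightarrow> l (T x) = L x"
proof -
  have T_eq: "L x = L y" if "x \<in> V" "y \<in> V" "T x = T y" for x y
  proof -
    \<comment> \<open>The difference is spelled as a sum because \<open>T\<close> is known to be
      additive and homogeneous only on \<open>V\<close>.\<close>
    have "T (x + - 1 *\<^sub>R y) = T x + - 1 *\<^sub>R T y"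
      using that(1,2) V by (simp only: add scale subspace_scale)
    then have "T (x - y) = 0" using that(3) by simp
    then show ?thesis
      using ker[OF subspace_diff[OF V that(1,2)]] linear_form_on_diff[OF L V that(1,2)] by simp
  qed
  define l where "l z = L (inv_into V T z)" for z
  have l: "l (T x) = L x" if "x \<in> V" for x
    unfolding l_def using that by (intro T_eq) (auto intro: inv_into_into f_inv_into_f)
  have "linear_form_on (T ` V) l"
    unfolding linear_form_on_def
  proof (intro conjI ballI allI; clarify)
    fix x y assume xy: "x \<in> V" "y \<in> V"
    have "l (T x + T y) = L (x + y)"
      using l[OF subspace_add[OF V xy]] add[OF xy] by simp
    then show "l (T x + T y) = l (T x) + l (T y)"
      using L xy l by (simp add: linear_form_on_def)
  next
    fix r x assume x: "x \<in> V"
    have "l (r *\<^sub>R T x) = L (r *\<^sub>R x)"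
      using l[OF subspace_scale[OF V x, of r]] scale[OF x, of r] by simp
    then show "l (r *\<^sub>R T x) = r * l (T x)"
      using L x l by (simp add: linear_form_on_def)
  qed
  then show thesis using l that by blast
qed

text \<open>A nonzero \<open>u\<close> annihilated by all test vectors would have only zero
  quotients, so its supremum, and with it the infimum, would not be positive.\<close>

lemma inf_sup_pos_imp_nondegenerate:
  assumes "inf_sup nrm b V > 0" "u \<in> V" "\<forall>v\<in>V. b u v = 0"
  shows "u = 0"
proof (rule ccontr)
  assume "u \<noteq> 0"
  then have ne: "V - {0} \<noteq> {}" using assms(2) by blast
  have "inf_sup nrm b V \<le> (SUP v\<in>V - {0}. ereal (b u v / (nrm u * nrm v)))"
    unfolding inf_sup_def using assms(2) \<open>u \<noteq> 0\<close> by (intro INF_lower) auto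
  also have "\<dots> = (SUP v\<in>V - {0}. 0)"
    using assms(3) by (intro SUP_cong) (auto simp: zero_ereal_def)
  also have "\<dots> = 0" using ne by simp
  finally show False using assms(1) by simp
qed

section \<open>Traces\<close>

lemma restrict_l2_add:
  assumes "open \<Omega>" "bounded \<Omega>" "smooth \<phi>" "smooth \<psi>"
  shows "restrict_l2 \<Omega> (\<lambda>x. \<phi> x + \<psi> x) = restrict_l2 \<Omega> \<phi> + restrict_l2 \<Omega> \<psi>"
  using abs_l2_add[OF square_integrable_restrict_smooth[OF assms(3,1,2)]
      square_integrable_restrict_smooth[OF assms(4,1,2)]]
  by (simp add: restrict_l2_def distrib_left)

lemma restrict_l2_scale:
  assumes "open \<Omega>" "bounded \<Omega>" "smooth \<phi>"
  shows "restrict_l2 \<Omega> (\<lambda>x. r * \<phi> x) = r *\<^sub>R restrict_l2 \<Omega> \<phi>"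
  using abs_l2_scale[OF square_integrable_restrict_smooth[OF assms(3,1,2)], of r]
  by (simp add: restrict_l2_def mult.left_commute)

lemma restrict_l2_zero: "restrict_l2 \<Omega> (\<lambda>x. 0) = 0"
  by (simp add: restrict_l2_def zero_l2_def)

text \<open>The sigma algebra of a \<open>measure_of\<close> does not depend on the set function, so
  measurability for the surface measure is Borel measurability.\<close>

lemma sets_surface_measure [measurable_cong]: "sets surface_measure = sets borel"
  using sets.sigma_sets_eq[of borel] by (simp add: surface_measure_def hausdorff_measure_def)

lemma has_trace_zero:
  assumes "open \<Omega>"
  shows "has_trace \<Omega> 0 (\<lambda>x. 0)"
  unfolding has_trace_def
  by (intro conjI exI[of _ "\<lambda>k x. 0"])
    (simp_all add: smooth_zero restrict_l2_zero partial_deriv_zero weak_pderiv_zero[OF assms])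

text \<open>The two approximating sequences are added. On the boundary
  \<open>(p + q)\<^sup>2 \<le> 2 * p\<^sup>2 + 2 * q\<^sup>2\<close> bounds the new error by twice
  the old ones, and a sandwich in the extended nonnegative reals gives the limit.\<close>

lemma has_trace_add:
  fixes \<Omega> :: "(real^'n::finite) set"
  assumes \<Omega>: "open \<Omega>" "bounded \<Omega>" and uv: "u \<in> H1 \<Omega>" "v \<in> H1 \<Omega>"
    and "has_trace \<Omega> u g" "has_trace \<Omega> v h"
  shows "has_trace \<Omega> (u + v) (\<lambda>x. g x + h x)"
proof -
  let ?I = "\<lambda>f. \<integral>\<^sup>+x\<in>frontier \<Omega>. ennreal ((f x)\<^sup>2) \<partial>surface_measure"
  obtain \<phi> where g: "g \<in> borel_measurable borel" and \<phi>: "\<And>k. smooth (\<phi> k)"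
    "(\<lambda>k. restrict_l2 \<Omega> (\<phi> k)) \<longlonglongrightarrow> u"
    "\<And>i. (\<lambda>k. restrict_l2 \<Omega> (partial_deriv i (\<phi> k))) \<longlonglongrightarrow> weak_pderiv \<Omega> i u"
    "(\<lambda>k. ?I (\<lambda>x. \<phi> k x - g x)) \<longlonglongrightarrow> 0"
    using assms(5) unfolding has_trace_def by blast
  obtain \<psi> where h: "h \<in> borel_measurable borel" and \<psi>: "\<And>k. smooth (\<psi> k)"
    "(\<lambda>k. restrict_l2 \<Omega> (\<psi> k)) \<longlonglongrightarrow> v"
    "\<And>i. (\<lambda>k. restrict_l2 \<Omega> (partial_deriv i (\<psi> k))) \<longlonglongrightarrow> weak_pderiv \<Omega> i v"
    "(\<lambda>k. ?I (\<lambda>x. \<psi> k x - h x)) \<longlonglongrightarrow> 0"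
    using assms(6) unfolding has_trace_def by blast
  note [measurable] = g h \<phi>(1)[THEN smooth_borel_measurable] \<psi>(1)[THEN smooth_borel_measurable]
  have frontier [measurable]: "frontier \<Omega> \<in> sets borel" by simp
  have meas: "(\<lambda>x. ennreal ((\<phi> k x - g x)\<^sup>2) * indicator (frontier \<Omega>) x) \<in> borel_measurable surface_measure"
    "(\<lambda>x. ennreal ((\<psi> k x - h x)\<^sup>2) * indicator (frontier \<Omega>) x) \<in> borel_measurable surface_measure" for k
    by measurable
  have bound: "?I (\<lambda>x. (\<phi> k x + \<psi> k x) - (g x + h x))
      \<le> 2 * ?I (\<lambda>x. \<phi> k x - g x) + 2 * ?I (\<lambda>x. \<psi> k x - h x)" for k
  proof -
    have "ennreal (((\<phi> k x + \<psi> k x) - (g x + h x))\<^sup>2)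
        \<le> 2 * ennreal ((\<phi> k x - g x)\<^sup>2) + 2 * ennreal ((\<psi> k x - h x)\<^sup>2)" for x
    proof -
      have "((\<phi> k x + \<psi> k x) - (g x + h x))\<^sup>2 \<le> 2 * (\<phi> k x - g x)\<^sup>2 + 2 * (\<psi> k x - h x)\<^sup>2"
        using sum_squares_bound[of "\<phi> k x - g x" "\<psi> k x - h x"]
        by (simp add: power2_eq_square algebra_simps)
      then have "ennreal (((\<phi> k x + \<psi> k x) - (g x + h x))\<^sup>2)
          \<le> ennreal (2 * (\<phi> k x - g x)\<^sup>2 + 2 * (\<psi> k x - h x)\<^sup>2)"
        by (rule ennreal_leI)
      then show ?thesis by (simp add: ennreal_plus ennreal_mult)
    qed
    then have "?I (\<lambda>x. (\<phi> k x + \<psi> k x) - (g x + h x))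
      \<le> (\<integral>\<^sup>+x. 2 * (ennreal ((\<phi> k x - g x)\<^sup>2) * indicator (frontier \<Omega>) x)
          + 2 * (ennreal ((\<psi> k x - h x)\<^sup>2) * indicator (frontier \<Omega>) x) \<partial>surface_measure)"
      by (intro nn_integral_mono) (auto simp: indicator_def)
    also have "\<dots> = 2 * ?I (\<lambda>x. \<phi> k x - g x) + 2 * ?I (\<lambda>x. \<psi> k x - h x)"
      by (subst nn_integral_add) (simp_all only: nn_integral_cmult meas borel_measurable_times_ennreal borel_measurable_const)
    finally show ?thesis .
  qed
  have "(\<lambda>k. 2 * ?I (\<lambda>x. \<phi> k x - g x) + 2 * ?I (\<lambda>x. \<psi> k x - h x)) \<longlonglongrightarrow> 2 * 0 + 2 * 0"
    by (intro tendsto_add ennreal_tendsto_cmult \<phi>(4) \<psi>(4)) simp_all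
  then have upper: "(\<lambda>k. 2 * ?I (\<lambda>x. \<phi> k x - g x) + 2 * ?I (\<lambda>x. \<psi> k x - h x)) \<longlonglongrightarrow> 0"
    by simp
  have lim: "(\<lambda>k. ?I (\<lambda>x. (\<phi> k x + \<psi> k x) - (g x + h x))) \<longlonglongrightarrow> 0"
    by (rule tendsto_sandwich[OF _ _ tendsto_const upper]) (intro always_eventually allI zero_le bound)+
  show ?thesis
    unfolding has_trace_def
  proof (intro conjI exI[of _ "\<lambda>k x. \<phi> k x + \<psi> k x"] allI)
    show "(\<lambda>k. restrict_l2 \<Omega> (\<lambda>x. \<phi> k x + \<psi> k x)) \<longlonglongrightarrow> u + v"
      unfolding restrict_l2_add[OF \<Omega> \<phi>(1) \<psi>(1)] by (intro tendsto_add \<phi> \<psi>)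
    show "(\<lambda>k. restrict_l2 \<Omega> (partial_deriv i (\<lambda>x. \<phi> k x + \<psi> k x))) \<longlonglongrightarrow> weak_pderiv \<Omega> i (u + v)" for i
      unfolding partial_deriv_add[OF \<phi>(1) \<psi>(1)] weak_pderiv_add[OF \<Omega>(1) uv]
        restrict_l2_add[OF \<Omega> smooth_partial_deriv[OF \<phi>(1)] smooth_partial_deriv[OF \<psi>(1)]]
      by (intro tendsto_add \<phi> \<psi>)
    show "(\<lambda>x. g x + h x) \<in> borel_measurable borel" by measurable
    show "smooth (\<lambda>x. \<phi> k x + \<psi> k x)" for k by (rule smooth_add[OF \<phi>(1) \<psi>(1)])
  qed (rule lim)
qed

lemma has_trace_scale:
  fixes \<Omega> :: "(real^'n::finite) set"
  assumes \<Omega>: "open \<Omega>" "bounded \<Omega>" and u: "u \<in> H1 \<Omega>" and "has_trace \<Omega> u g"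
  shows "has_trace \<Omega> (r *\<^sub>R u) (\<lambda>x. r * g x)"
proof -
  let ?I = "\<lambda>f. \<integral>\<^sup>+x\<in>frontier \<Omega>. ennreal ((f x)\<^sup>2) \<partial>surface_measure"
  obtain \<phi> where g: "g \<in> borel_measurable borel" and \<phi>: "\<And>k. smooth (\<phi> k)"
    "(\<lambda>k. restrict_l2 \<Omega> (\<phi> k)) \<longlonglongrightarrow> u"
    "\<And>i. (\<lambda>k. restrict_l2 \<Omega> (partial_deriv i (\<phi> k))) \<longlonglongrightarrow> weak_pderiv \<Omega> i u"
    "(\<lambda>k. ?I (\<lambda>x. \<phi> k x - g x)) \<longlonglongrightarrow> 0"
    using assms(4) unfolding has_trace_def by blast
  note [measurable] = g \<phi>(1)[THEN smooth_borel_measurable]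
  have frontier [measurable]: "frontier \<Omega> \<in> sets borel" by simp
  have meas: "(\<lambda>x. ennreal ((\<phi> k x - g x)\<^sup>2) * indicator (frontier \<Omega>) x) \<in> borel_measurable surface_measure" for k
    by measurable
  \<comment> \<open>The boundary error is quadratic, hence the factor
    \<open>r\<^sup>2\<close>.\<close>
  have "?I (\<lambda>x. r * \<phi> k x - r * g x) = ennreal (r\<^sup>2) * ?I (\<lambda>x. \<phi> k x - g x)" for k
  proof -
    have "ennreal ((r * \<phi> k x - r * g x)\<^sup>2) = ennreal (r\<^sup>2) * ennreal ((\<phi> k x - g x)\<^sup>2)" for x
      by (simp flip: right_diff_distrib ennreal_mult power_mult_distrib)
    then show ?thesis by (simp only: mult.assoc nn_integral_cmult[OF meas])
  qed
  moreover have "(\<lambda>k. ennreal (r\<^sup>2) * ?I (\<lambda>x. \<phi> k x - g x)) \<longlonglongrightarrow> ennreal (r\<^sup>2) * 0"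
    by (intro ennreal_tendsto_cmult \<phi>) simp
  ultimately have lim: "(\<lambda>k. ?I (\<lambda>x. r * \<phi> k x - r * g x)) \<longlonglongrightarrow> 0" by simp
  show ?thesis
    unfolding has_trace_def
  proof (intro conjI exI[of _ "\<lambda>k x. r * \<phi> k x"] allI)
    show "(\<lambda>k. restrict_l2 \<Omega> (\<lambda>x. r * \<phi> k x)) \<longlonglongrightarrow> r *\<^sub>R u"
      unfolding restrict_l2_scale[OF \<Omega> \<phi>(1)] by (intro tendsto_scaleR tendsto_const \<phi>)
    show "(\<lambda>k. restrict_l2 \<Omega> (partial_deriv i (\<lambda>x. r * \<phi> k x))) \<longlonglongrightarrow> weak_pderiv \<Omega> i (r *\<^sub>R u)" for i
      unfolding partial_deriv_scale[OF \<phi>(1)] weak_pderiv_scale[OF \<Omega>(1) u]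
        restrict_l2_scale[OF \<Omega> smooth_partial_deriv[OF \<phi>(1)]]
      by (intro tendsto_scaleR tendsto_const \<phi>)
    show "(\<lambda>x. r * g x) \<in> borel_measurable borel" by measurable
    show "smooth (\<lambda>x. r * \<phi> k x)" for k by (rule smooth_scale[OF \<phi>(1)])
  qed (rule lim)
qed

lemma subspace_H1_\<Gamma>:
  assumes \<Omega>: "open \<Omega>" "bounded \<Omega>"
  shows "subspace (H1_\<Gamma> \<Omega> \<Gamma>c \<Gamma>s)"
proof (rule subspaceI)
  show "0 \<in> H1_\<Gamma> \<Omega> \<Gamma>c \<Gamma>s"
    using has_trace_zero[OF \<Omega>(1)] subspace_0[OF subspace_H1] by (auto simp: H1_\<Gamma>_def)
next
  fix u v assume u: "u \<in> H1_\<Gamma> \<Omega> \<Gamma>c \<Gamma>s" and v: "v \<in> H1_\<Gamma> \<Omega> \<Gamma>c \<Gamma>s"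
  obtain g where g: "u \<in> H1 \<Omega>" "has_trace \<Omega> u g"
    "AE x in surface_measure. x \<in> \<Gamma>c \<union> \<Gamma>s \<longrightarrow> g x = 0"
    using u unfolding H1_\<Gamma>_def by blast
  obtain h where h: "v \<in> H1 \<Omega>" "has_trace \<Omega> v h"
    "AE x in surface_measure. x \<in> \<Gamma>c \<union> \<Gamma>s \<longrightarrow> h x = 0"
    using v unfolding H1_\<Gamma>_def by blast
  have "AE x in surface_measure. x \<in> \<Gamma>c \<union> \<Gamma>s \<longrightarrow> g x + h x = 0"
    using g(3) h(3) by eventually_elim simp
  then show "u + v \<in> H1_\<Gamma> \<Omega> \<Gamma>c \<Gamma>s"
    unfolding H1_\<Gamma>_def
    by (intro CollectI conjI exI[of _ "\<lambda>x. g x + h x"] has_trace_add[OF \<Omega> g(1) h(1) g(2) h(2)]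
        subspace_add[OF subspace_H1 g(1) h(1)])
next
  fix r u assume u: "u \<in> H1_\<Gamma> \<Omega> \<Gamma>c \<Gamma>s"
  obtain g where g: "u \<in> H1 \<Omega>" "has_trace \<Omega> u g"
    "AE x in surface_measure. x \<in> \<Gamma>c \<union> \<Gamma>s \<longrightarrow> g x = 0"
    using u unfolding H1_\<Gamma>_def by blast
  have "AE x in surface_measure. x \<in> \<Gamma>c \<union> \<Gamma>s \<longrightarrow> r * g x = 0"
    using g(3) by eventually_elim simp
  then show "r *\<^sub>R u \<in> H1_\<Gamma> \<Omega> \<Gamma>c \<Gamma>s"
    unfolding H1_\<Gamma>_def
    by (intro CollectI conjI exI[of _ "\<lambda>x. r * g x"] has_trace_scale[OF \<Omega> g(1,2)]
        subspace_scale[OF subspace_H1 g(1)])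
qed

lemma subspace_H1_vec: "subspace (H1_vec \<Omega>)"
  by (rule subspaceI)
    (simp_all add: H1_vec_def subspace_0 subspace_add subspace_scale subspace_H1)

lemma tangential_add: "tangential n (x + y) = tangential n x + tangential n y"
  by (simp add: tangential_def inner_add_left algebra_simps)

lemma tangential_scale: "tangential n (r *\<^sub>R x) = r *\<^sub>R tangential n x"
  by (simp add: tangential_def algebra_simps)

text \<open>At each boundary point both conditions are linear, the second because
  \<open>tangential n\<close> is linear for any fixed \<open>n\<close>; so sums and multiples of
  boundary values satisfy them off a null set.\<close>

lemma subspace_G_\<Gamma>:
  assumes \<Omega>: "open \<Omega>" "bounded \<Omega>"
  shows "subspace (G_\<Gamma> \<Omega> \<Gamma>c \<Gamma>s)"
proof (rule subspaceI)
  have "has_trace_vec \<Omega> 0 (\<lambda>x. 0)"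
    using has_trace_zero[OF \<Omega>(1)] by (simp add: has_trace_vec_def)
  then show "0 \<in> G_\<Gamma> \<Omega> \<Gamma>c \<Gamma>s"
    using subspace_0[OF subspace_H1_vec]
    by (auto simp: G_\<Gamma>_def tangential_def intro!: exI[of _ "\<lambda>x. 0"])
next
  fix u v assume u: "u \<in> G_\<Gamma> \<Omega> \<Gamma>c \<Gamma>s" and v: "v \<in> G_\<Gamma> \<Omega> \<Gamma>c \<Gamma>s"
  obtain g where g: "u \<in> H1_vec \<Omega>" "has_trace_vec \<Omega> u g"
    "AE x in surface_measure. x \<in> \<Gamma>c \<longrightarrow> g x = 0"
    "AE x in surface_measure. x \<in> \<Gamma>s \<longrightarrow> tangential (outward_normal \<Omega> x) (g x) = 0"
    using u unfolding G_\<Gamma>_def by blast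
  obtain h where h: "v \<in> H1_vec \<Omega>" "has_trace_vec \<Omega> v h"
    "AE x in surface_measure. x \<in> \<Gamma>c \<longrightarrow> h x = 0"
    "AE x in surface_measure. x \<in> \<Gamma>s \<longrightarrow> tangential (outward_normal \<Omega> x) (h x) = 0"
    using v unfolding G_\<Gamma>_def by blast
  have "AE x in surface_measure. x \<in> \<Gamma>c \<longrightarrow> g x + h x = 0"
    using g(3) h(3) by eventually_elim simp
  moreover have "AE x in surface_measure. x \<in> \<Gamma>s \<longrightarrow> tangential (outward_normal \<Omega> x) (g x + h x) = 0"
    using g(4) h(4) by eventually_elim (simp add: tangential_add)
  moreover have "has_trace_vec \<Omega> (u + v) (\<lambda>x. g x + h x)"
    unfolding has_trace_vec_def vector_add_component
    using g(1,2) h(1,2) by (auto simp: has_trace_vec_def H1_vec_def intro: has_trace_add[OF \<Omega>])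
  ultimately show "u + v \<in> G_\<Gamma> \<Omega> \<Gamma>c \<Gamma>s"
    unfolding G_\<Gamma>_def
    by (intro CollectI conjI exI[of _ "\<lambda>x. g x + h x"] subspace_add[OF subspace_H1_vec g(1) h(1)])
next
  fix r u assume u: "u \<in> G_\<Gamma> \<Omega> \<Gamma>c \<Gamma>s"
  obtain g where g: "u \<in> H1_vec \<Omega>" "has_trace_vec \<Omega> u g"
    "AE x in surface_measure. x \<in> \<Gamma>c \<longrightarrow> g x = 0"
    "AE x in surface_measure. x \<in> \<Gamma>s \<longrightarrow> tangential (outward_normal \<Omega> x) (g x) = 0"
    using u unfolding G_\<Gamma>_def by blast
  have "AE x in surface_measure. x \<in> \<Gamma>c \<longrightarrow> r *\<^sub>R g x = 0"
    using g(3) by eventually_elim simp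
  moreover have "AE x in surface_measure. x \<in> \<Gamma>s \<longrightarrow> tangential (outward_normal \<Omega> x) (r *\<^sub>R g x) = 0"
    using g(4) by eventually_elim (simp add: tangential_scale)
  moreover have "has_trace_vec \<Omega> (r *\<^sub>R u) (\<lambda>x. r *\<^sub>R g x)"
    unfolding has_trace_vec_def vector_scaleR_component real_scaleR_def
    using g(1,2) by (auto simp: has_trace_vec_def H1_vec_def intro: has_trace_scale[OF \<Omega>])
  ultimately show "r *\<^sub>R u \<in> G_\<Gamma> \<Omega> \<Gamma>c \<Gamma>s"
    unfolding G_\<Gamma>_def
    by (intro CollectI conjI exI[of _ "\<lambda>x. r *\<^sub>R g x"] subspace_scale[OF subspace_H1_vec g(1)])
qed

text \<open>A gradient with components in \<open>H1 \<Omega>\<close> puts \<open>v\<close> in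
  \<open>H2 \<Omega>\<close>, and a gradient trace that vanishes on \<open>\<Gamma>c\<close> has
  vanishing normal component there. This makes the conforming space a subset of
  \<open>H2_\<Gamma>\<close>.\<close>

lemma H2_\<Gamma>_if_weak_grad_in_G_\<Gamma>:
  assumes "v \<in> H1_\<Gamma> \<Omega> \<Gamma>c \<Gamma>s" "weak_grad \<Omega> v \<in> G_\<Gamma> \<Omega> \<Gamma>c \<Gamma>s"
  shows "v \<in> H2_\<Gamma> \<Omega> \<Gamma>c \<Gamma>s"
proof -
  obtain g where g: "has_trace_vec \<Omega> (weak_grad \<Omega> v) g" "AE x in surface_measure. x \<in> \<Gamma>c \<longrightarrow> g x = 0"
    using assms(2) unfolding G_\<Gamma>_def by blast
  have "AE x in surface_measure. x \<in> \<Gamma>c \<longrightarrow> inner (g x) (outward_normal \<Omega> x) = 0"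
    using g(2) by eventually_elim simp
  moreover have "v \<in> H2 \<Omega>"
    using assms by (simp add: H1_\<Gamma>_def G_\<Gamma>_def H2_def H1_vec_def weak_grad_def)
  ultimately show ?thesis
    using assms(1) g(1) unfolding H2_\<Gamma>_def H1_\<Gamma>_def by blast
qed

text \<open>\<open>weak_grad\<close> is linear only on \<open>H1 \<Omega>\<close>, so the argument
  shows that the vectors with the claimed property form a subspace containing
  \<open>S\<close>.\<close>

lemma weak_grad_in_span:
  assumes "open \<Omega>" "span S \<subseteq> H1 \<Omega>" "v \<in> span S"
  shows "weak_grad \<Omega> v \<in> span (weak_grad \<Omega> ` S)"
proof -
  have "subspace {v \<in> span S. weak_grad \<Omega> v \<in> span (weak_grad \<Omega> ` S)}"
  proof (rule subspaceI, goal_cases)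
    case 1
    then show ?case by (simp add: weak_grad_zero[OF assms(1)] span_zero)
  next
    case (2 x y)
    then have "weak_grad \<Omega> (x + y) = weak_grad \<Omega> x + weak_grad \<Omega> y"
      using assms(2) by (intro weak_grad_add[OF assms(1)]) auto
    with 2 show ?case by (simp add: span_add)
  next
    case (3 r x)
    then have "weak_grad \<Omega> (r *\<^sub>R x) = r *\<^sub>R weak_grad \<Omega> x"
      using assms(2) by (intro weak_grad_scale[OF assms(1)]) auto
    with 3 show ?case by (simp add: span_scale)
  qed
  moreover have "S \<subseteq> {v \<in> span S. weak_grad \<Omega> v \<in> span (weak_grad \<Omega> ` S)}"
    by (auto intro: span_base)
  ultimately show ?thesis using assms(3) span_minimal by blast
qed

section \<open>The mixed problem\<close>

lemma Xi_add:
  assumes "open \<Omega>" "p \<in> H1 \<Omega> \<times> V" "p' \<in> H1 \<Omega> \<times> V"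
  shows "Xi \<Omega> (p + p') = Xi \<Omega> p + Xi \<Omega> p'"
  using assms by (auto simp: Xi_def weak_grad_add)

lemma Xi_scale:
  assumes "open \<Omega>" "p \<in> H1 \<Omega> \<times> V"
  shows "Xi \<Omega> (r *\<^sub>R p) = r *\<^sub>R Xi \<Omega> p"
  using assms by (auto simp: Xi_def weak_grad_scale scaleR_diff_right)

lemma subspace_Xi_image:
  assumes "open \<Omega>" "subspace V" "subspace U" "V \<subseteq> H1 \<Omega>"
  shows "subspace (Xi \<Omega> ` (V \<times> U))"
proof (rule subspaceI)
  have VU: "V \<times> U \<subseteq> H1 \<Omega> \<times> U" by (rule Sigma_mono[OF assms(4) subset_refl])
  have "(0, 0) \<in> V \<times> U" "Xi \<Omega> (0, 0) = 0"
    using assms by (simp_all add: subspace_0 Xi_def weak_grad_zero)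
  then show "0 \<in> Xi \<Omega> ` (V \<times> U)" by (metis image_eqI)
  show "x + y \<in> Xi \<Omega> ` (V \<times> U)" if xy: "x \<in> Xi \<Omega> ` (V \<times> U)" "y \<in> Xi \<Omega> ` (V \<times> U)" for x y
  proof -
    obtain p p' where p: "p \<in> V \<times> U" "p' \<in> V \<times> U" "x = Xi \<Omega> p" "y = Xi \<Omega> p'"
      using xy by blast
    have "x + y = Xi \<Omega> (p + p')"
      unfolding p(3,4) using Xi_add[OF assms(1) subsetD[OF VU p(1)] subsetD[OF VU p(2)]] by simp
    moreover have "p + p' \<in> V \<times> U" using p assms by (auto simp: subspace_add)
    ultimately show ?thesis by (rule image_eqI)
  qed
  show "r *\<^sub>R x \<in> Xi \<Omega> ` (V \<times> U)" if x: "x \<in> Xi \<Omega> ` (V \<times> U)" for r x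
  proof -
    obtain p where p: "p \<in> V \<times> U" "x = Xi \<Omega> p"
      using x by blast
    have "r *\<^sub>R x = Xi \<Omega> (r *\<^sub>R p)"
      unfolding p(2) using Xi_scale[OF assms(1) subsetD[OF VU p(1)], of r] by simp
    moreover have "r *\<^sub>R p \<in> V \<times> U" using p assms by (auto simp: subspace_scale)
    ultimately show ?thesis by (rule image_eqI)
  qed
qed

lemma linear_form_on_Times:
  assumes "linear_form_on V F" "linear_form_on U G"
  shows "linear_form_on (V \<times> U) (\<lambda>(v, u). F v + G u)"
  using assms unfolding linear_form_on_def by (auto simp: algebra_simps)

lemma linear_form_on_minus:
  assumes "linear_form_on V F" "linear_form_on V G"
  shows "linear_form_on V (\<lambda>v. F v - G v)"
  using assms unfolding linear_form_on_def by (auto simp: algebra_simps)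

text \<open>Supplies the right-hand side of the conforming problem as one linear form on the space
  of functions with conforming gradient.\<close>

lemma linear_form_on_weak_grad:
  assumes "open \<Omega>" "W \<subseteq> H1 \<Omega>" "\<And>v. v \<in> W \<Longrightarrow> weak_grad \<Omega> v \<in> G" "W \<subseteq> V"
    and "linear_form_on G F1" "linear_form_on V F2"
  shows "linear_form_on W (\<lambda>v. F1 (weak_grad \<Omega> v) + F2 v)"
  unfolding linear_form_on_def
proof (intro conjI ballI allI)
  show "F1 (weak_grad \<Omega> (x + y)) + F2 (x + y)
      = F1 (weak_grad \<Omega> x) + F2 x + (F1 (weak_grad \<Omega> y) + F2 y)" if "x \<in> W" "y \<in> W" for x y
  proof -
    have "weak_grad \<Omega> (x + y) = weak_grad \<Omega> x + weak_grad \<Omega> y"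
      using that assms(2) by (intro weak_grad_add[OF assms(1)]) auto
    moreover have "F1 (weak_grad \<Omega> x + weak_grad \<Omega> y) = F1 (weak_grad \<Omega> x) + F1 (weak_grad \<Omega> y)"
      using assms(3,5) that by (simp add: linear_form_on_def)
    moreover have "F2 (x + y) = F2 x + F2 y"
      using assms(4,6) that unfolding linear_form_on_def by blast
    ultimately show ?thesis by simp
  qed
  show "F1 (weak_grad \<Omega> (r *\<^sub>R x)) + F2 (r *\<^sub>R x) = r * (F1 (weak_grad \<Omega> x) + F2 x)" if "x \<in> W" for r x
  proof -
    have "weak_grad \<Omega> (r *\<^sub>R x) = r *\<^sub>R weak_grad \<Omega> x"
      using that assms(2) by (intro weak_grad_scale[OF assms(1)]) auto
    moreover have "F1 (r *\<^sub>R weak_grad \<Omega> x) = r * F1 (weak_grad \<Omega> x)"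
      using assms(3,5) that by (simp add: linear_form_on_def)
    moreover have "F2 (r *\<^sub>R x) = r * F2 x"
      using assms(4,6) that unfolding linear_form_on_def by blast
    ultimately show ?thesis by (simp add: algebra_simps)
  qed
qed

theorem theorem4p1:
  fixes \<Omega> \<Gamma>c \<Gamma>s \<Gamma>f :: "(real^'n::finite) set"
    and e :: "nat \<Rightarrow> 'n"
    and B c :: "(real^'n) l2 \<Rightarrow> (real^'n) l2 \<Rightarrow> real"
    and a :: "(real^'n) l2 ^ 'n \<Rightarrow> (real^'n) l2 ^ 'n \<Rightarrow> real"
    and W W\<Gamma> WX :: "(real^'n) l2 set"
    and G G\<Gamma> Q\<Gamma> :: "((real^'n) l2 ^ 'n) set"
    and F1 :: "(real^'n) l2 ^ 'n \<Rightarrow> real"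
    and F2 :: "(real^'n) l2 \<Rightarrow> real"
  assumes dim: "CARD('n) = 2 \<or> CARD('n) = 3"
    and axes: "bij_betw e {1..CARD('n)} UNIV"
    and domain: "polyhedral_lipschitz_domain \<Omega>"
    and boundary: "boundary_partition \<Omega> \<Gamma>c \<Gamma>s \<Gamma>f"
    and geo2: "CARD('n) = 2 \<Longrightarrow> geometry_2d \<Omega>"
    and geo3: "CARD('n) = 3 \<Longrightarrow> geometry_3d \<Omega> (\<Gamma>c \<union> \<Gamma>s)"
    and B_bilinear: "bilinear_form_on (H2 \<Omega>) B"
    and B_bounded: "\<exists>M>0. \<forall>u\<in>H2 \<Omega>. \<forall>v\<in>H2 \<Omega>. \<bar>B u v\<bar> \<le> M * norm_H2 \<Omega> u * norm_H2 \<Omega> v"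
    and B_inf_sup: "\<exists>\<alpha>>0. inf_sup (norm_H2 \<Omega>) B (H2_\<Gamma> \<Omega> \<Gamma>c \<Gamma>s) \<ge> ereal \<alpha>"
    and B_nondegenerate:
      "\<forall>v\<in>H2_\<Gamma> \<Omega> \<Gamma>c \<Gamma>s. v \<noteq> 0 \<longrightarrow> (SUP u\<in>H2_\<Gamma> \<Omega> \<Gamma>c \<Gamma>s. ereal (B u v)) > 0"
    and split: "splitting \<Omega> B a c"
    and W: "subspace W" "\<exists>S. finite S \<and> W = span S" "W \<subseteq> H1 \<Omega>"
    and G: "subspace G" "\<exists>S. finite S \<and> G = span S" "G \<subseteq> H1_vec \<Omega>"
    and W\<Gamma>: "W\<Gamma> = W \<inter> H1_\<Gamma> \<Omega> \<Gamma>c \<Gamma>s"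
    and G\<Gamma>: "G\<Gamma> = G \<inter> G_\<Gamma> \<Omega> \<Gamma>c \<Gamma>s"
    and Q\<Gamma>: "Q\<Gamma> = Xi \<Omega> ` (W\<Gamma> \<times> G\<Gamma>)"
    and WX: "WX = {v \<in> W\<Gamma>. weak_grad \<Omega> v \<in> G\<Gamma>}"
    and WX_inf_sup: "inf_sup (norm_H2 \<Omega>) B WX > 0"
    and F1: "linear_form_on G\<Gamma> F1"
    and F2: "linear_form_on W\<Gamma> F2"
  shows "WX \<subseteq> H2_\<Gamma> \<Omega> \<Gamma>c \<Gamma>s \<and>
    (\<exists>!s. mixed_solution \<Omega> e a c F1 F2 W\<Gamma> G\<Gamma> Q\<Gamma> s) \<and>
    (\<exists>!w. conforming_solution \<Omega> B F1 F2 WX w) \<and>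
    (\<forall>w \<gamma> q wX. mixed_solution \<Omega> e a c F1 F2 W\<Gamma> G\<Gamma> Q\<Gamma> (w, \<gamma>, q) \<longrightarrow>
       conforming_solution \<Omega> B F1 F2 WX wX \<longrightarrow> w = wX \<and> \<gamma> = weak_grad \<Omega> wX) \<and>
    (\<forall>a' c' w \<gamma> q w' \<gamma>' q'. splitting \<Omega> B a' c' \<longrightarrow>
       mixed_solution \<Omega> e a c F1 F2 W\<Gamma> G\<Gamma> Q\<Gamma> (w, \<gamma>, q) \<longrightarrow>
       mixed_solution \<Omega> e a' c' F1 F2 W\<Gamma> G\<Gamma> Q\<Gamma> (w', \<gamma>', q') \<longrightarrow> w' = w)"
proof -
  have o\<Omega>: "open \<Omega>" and b\<Omega>: "bounded \<Omega>"
    using domain by (auto simp: polyhedral_lipschitz_domain_def lipschitz_domain_def)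
  have W\<Gamma>_H1: "W\<Gamma> \<subseteq> H1 \<Omega>" and G\<Gamma>_H1: "G\<Gamma> \<subseteq> H1_vec \<Omega>"
    using W(3) G(3) W\<Gamma> G\<Gamma> by blast+
  have sub_W\<Gamma>: "subspace W\<Gamma>" and sub_G\<Gamma>: "subspace G\<Gamma>"
    unfolding W\<Gamma> G\<Gamma>
    by (intro subspace_inter W(1) G(1) subspace_H1_\<Gamma> subspace_G_\<Gamma> o\<Omega> b\<Omega>)+
  have sub_Q\<Gamma>: "subspace Q\<Gamma>"
    unfolding Q\<Gamma> by (intro subspace_Xi_image o\<Omega> sub_W\<Gamma> sub_G\<Gamma> W\<Gamma>_H1)
  have WX_W\<Gamma>: "WX \<subseteq> W\<Gamma>" and WX_H1: "WX \<subseteq> H1 \<Omega>" using WX W\<Gamma>_H1 by blast+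
  have grad_WX: "weak_grad \<Omega> v \<in> G\<Gamma>" if "v \<in> WX" for v using that WX by simp
  have sub_WX: "subspace WX"
  proof (rule subspaceI)
    show "0 \<in> WX"
      by (simp add: WX weak_grad_zero[OF o\<Omega>] subspace_0[OF sub_W\<Gamma>] subspace_0[OF sub_G\<Gamma>])
    show "x + y \<in> WX" if xy: "x \<in> WX" "y \<in> WX" for x y
    proof -
      have "weak_grad \<Omega> (x + y) = weak_grad \<Omega> x + weak_grad \<Omega> y"
        using xy WX_H1 by (intro weak_grad_add[OF o\<Omega>]) auto
      then show ?thesis
        using xy by (simp add: WX subspace_add[OF sub_W\<Gamma>] subspace_add[OF sub_G\<Gamma>])
    qed
    show "r *\<^sub>R x \<in> WX" if x: "x \<in> WX" for r x
    proof -
      have "weak_grad \<Omega> (r *\<^sub>R x) = r *\<^sub>R weak_grad \<Omega> x"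
        using x WX_H1 by (intro weak_grad_scale[OF o\<Omega>]) auto
      then show ?thesis
        using x by (simp add: WX subspace_scale[OF sub_W\<Gamma>] subspace_scale[OF sub_G\<Gamma>])
    qed
  qed
  have WX_H2\<Gamma>: "WX \<subseteq> H2_\<Gamma> \<Omega> \<Gamma>c \<Gamma>s"
    using H2_\<Gamma>_if_weak_grad_in_G_\<Gamma> unfolding WX W\<Gamma> G\<Gamma> by blast
  then have WX_H2: "WX \<subseteq> H2 \<Omega>" unfolding H2_\<Gamma>_def by blast
  have Q\<Gamma>_rot: "Q\<Gamma> \<subseteq> H_rot \<Omega>"
    unfolding Q\<Gamma> using Xi_in_H_rot[OF o\<Omega>] W\<Gamma>_H1 G\<Gamma>_H1 by blast
  note curl_bilinear = bilinear_form_on_inner_curl[OF o\<Omega> Q\<Gamma>_rot, of e]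

  obtain SW where SW: "finite SW" "W = span SW" using W(2) by blast
  obtain SG where SG: "finite SG" "G = span SG" using G(2) by blast
  have WX_fin: "WX \<subseteq> span SW" using WX W\<Gamma> SW(2) by blast
  \<comment> \<open>Gradients of a spanning set of \<open>W\<close> together with a spanning set of
    \<open>G\<close> capture every \<open>Xi\<close> value; this is the finite-dimensionality behind
    the multiplier.\<close>
  have Q\<Gamma>_fin: "Q\<Gamma> \<subseteq> span (weak_grad \<Omega> ` SW \<union> SG)"
  proof
    fix \<eta> assume "\<eta> \<in> Q\<Gamma>"
    then obtain v \<psi> where v: "v \<in> W\<Gamma>" "\<psi> \<in> G\<Gamma>" "\<eta> = weak_grad \<Omega> v - \<psi>"
      unfolding Q\<Gamma> Xi_def by auto
    have "weak_grad \<Omega> v \<in> span (weak_grad \<Omega> ` SW)"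
      using v(1) W(3) SW(2) W\<Gamma> by (intro weak_grad_in_span[OF o\<Omega>]) auto
    moreover have "\<psi> \<in> span SG" using v(2) G\<Gamma> SG(2) by blast
    ultimately show "\<eta> \<in> span (weak_grad \<Omega> ` SW \<union> SG)"
      unfolding v(3) using span_mono[of "weak_grad \<Omega> ` SW" "weak_grad \<Omega> ` SW \<union> SG"]
        span_mono[of SG "weak_grad \<Omega> ` SW \<union> SG"] by (intro span_diff) auto
  qed

  have conforming: "\<exists>!w. conforming_solution \<Omega> B F1 F2 WX w"
    unfolding conforming_solution_def
    using ex1_bilinear_form_on[OF bilinear_form_on_subset[OF B_bilinear WX_H2] sub_WX SW(1) WX_fin
        inf_sup_pos_imp_nondegenerate[OF WX_inf_sup]
        linear_form_on_weak_grad[OF o\<Omega> WX_H1 grad_WX WX_W\<Gamma> F1 F2]] .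

  \<comment> \<open>Stated for arbitrary \<open>a\<close> and \<open>c\<close>, so that it also
    applies to a second splitting.\<close>
  have mixed_imp: "\<gamma> = weak_grad \<Omega> w \<and> conforming_solution \<Omega> B F1 F2 WX w"
    if s: "splitting \<Omega> B a c" and m: "mixed_solution \<Omega> e a c F1 F2 W\<Gamma> G\<Gamma> Q\<Gamma> (w, \<gamma>, q)"
    for a c w \<gamma> q
  proof -
    have mem: "w \<in> W\<Gamma>" "\<gamma> \<in> G\<Gamma>" "q \<in> Q\<Gamma>"
      and eq1: "\<And>v \<psi>. v \<in> W\<Gamma> \<Longrightarrow> \<psi> \<in> G\<Gamma> \<Longrightarrow>
        a \<gamma> \<psi> + c w v + inner_curl \<Omega> e (Xi \<Omega> (v, \<psi>)) q = F1 \<psi> + F2 v"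
      and eq2: "\<And>\<eta>. \<eta> \<in> Q\<Gamma> \<Longrightarrow> inner_curl \<Omega> e (Xi \<Omega> (w, \<gamma>)) \<eta> = 0"
      using m by (auto simp: mixed_solution_def)
    have "Xi \<Omega> (w, \<gamma>) \<in> Q\<Gamma>" unfolding Q\<Gamma> using mem by blast
    then have "Xi \<Omega> (w, \<gamma>) = 0" using eq2 inner_curl_self_eq_0 by blast
    then have \<gamma>: "\<gamma> = weak_grad \<Omega> w" by (simp add: Xi_def)
    then have w: "w \<in> WX" using mem WX by simp
    have "B w v = F1 (weak_grad \<Omega> v) + F2 v" if v: "v \<in> WX" for v
    proof -
      \<comment> \<open>The value at 0 is taken from linearity on \<open>Q\<Gamma>\<close>, since
        the curl of 0 is again a definite description.\<close>
      have "inner_curl \<Omega> e 0 q = 0"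
        using curl_bilinear mem(3) linear_form_on_zero[OF _ sub_Q\<Gamma>, of "\<lambda>x. inner_curl \<Omega> e x q"]
        by (simp add: bilinear_form_on_def)
      moreover have "Xi \<Omega> (v, weak_grad \<Omega> v) = 0" by (simp add: Xi_def)
      moreover have "B w v = a (weak_grad \<Omega> w) (weak_grad \<Omega> v) + c w v"
        using s w v WX_H2 unfolding splitting_def by blast
      ultimately show ?thesis
        using eq1[of v "weak_grad \<Omega> v"] v WX_W\<Gamma> grad_WX[OF v] \<gamma> by auto
    qed
    then show ?thesis using \<gamma> w by (simp add: conforming_solution_def)
  qed

  have a_lin: "linear_form_on G\<Gamma> (a \<theta>)" if "\<theta> \<in> G\<Gamma>" for \<theta>
    using split that G\<Gamma>_H1 linear_form_on_subset unfolding splitting_def bilinear_form_on_def by blast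
  have c_lin: "linear_form_on W\<Gamma> (c w)" if "w \<in> W\<Gamma>" for w
    using split that W\<Gamma>_H1 linear_form_on_subset unfolding splitting_def bilinear_form_on_def by blast

  obtain w where w: "conforming_solution \<Omega> B F1 F2 WX w" using conforming by blast
  then have w_WX: "w \<in> WX" by (simp add: conforming_solution_def)
  have w_W\<Gamma>: "w \<in> W\<Gamma>" using w_WX WX_W\<Gamma> by blast
  define \<gamma> where "\<gamma> = weak_grad \<Omega> w"
  have \<gamma>_G\<Gamma>: "\<gamma> \<in> G\<Gamma>" unfolding \<gamma>_def by (rule grad_WX[OF w_WX])
  \<comment> \<open>The residual of the first equation at \<open>(w, \<gamma>)\<close> without the
    multiplier term, as a form in the test pair.\<close>
  define L where "L = (\<lambda>(v, \<psi>). (F2 v - c w v) + (F1 \<psi> - a \<gamma> \<psi>))"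
  have L: "linear_form_on (W\<Gamma> \<times> G\<Gamma>) L"
    unfolding L_def
    by (intro linear_form_on_Times linear_form_on_minus F1 F2 a_lin c_lin w_W\<Gamma> \<gamma>_G\<Gamma>)
  have W\<Gamma>G\<Gamma>: "W\<Gamma> \<times> G\<Gamma> \<subseteq> H1 \<Omega> \<times> G\<Gamma>" by (rule Sigma_mono[OF W\<Gamma>_H1 subset_refl])
  have ker: "L p = 0" if p: "p \<in> W\<Gamma> \<times> G\<Gamma>" "Xi \<Omega> p = 0" for p
  proof -
    obtain v \<psi> where "p = (v, \<psi>)" by (cases p)
    \<comment> \<open>A kernel pair has \<open>\<psi> = weak_grad \<Omega> v\<close>, and
      \<open>\<psi> \<in> G\<Gamma>\<close> then places \<open>v\<close> in the conforming
      space.\<close>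
    then have v: "v \<in> WX" "p = (v, weak_grad \<Omega> v)"
      using p by (simp_all add: Xi_def WX)
    have "B w v = a \<gamma> (weak_grad \<Omega> v) + c w v"
      using split w_WX v(1) WX_H2 unfolding splitting_def \<gamma>_def by blast
    then show ?thesis using w v by (simp add: conforming_solution_def L_def)
  qed
  obtain l where l: "linear_form_on Q\<Gamma> l" and l_Xi: "\<And>p. p \<in> W\<Gamma> \<times> G\<Gamma> \<Longrightarrow> l (Xi \<Omega> p) = L p"
    unfolding Q\<Gamma>
  proof (rule linear_form_on_factor[OF subspace_Times[OF sub_W\<Gamma> sub_G\<Gamma>] L, of "Xi \<Omega>"])
    show "Xi \<Omega> (x + y) = Xi \<Omega> x + Xi \<Omega> y" if "x \<in> W\<Gamma> \<times> G\<Gamma>" "y \<in> W\<Gamma> \<times> G\<Gamma>" for x y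
      using that W\<Gamma>G\<Gamma> by (intro Xi_add[OF o\<Omega>]) (rule subsetD; assumption)+
    show "Xi \<Omega> (r *\<^sub>R x) = r *\<^sub>R Xi \<Omega> x" if "x \<in> W\<Gamma> \<times> G\<Gamma>" for r x
      using that W\<Gamma>G\<Gamma> by (intro Xi_scale[OF o\<Omega>]) (rule subsetD; assumption)
  qed (use ker in blast)+
  have multiplier: "\<exists>!q. q \<in> Q\<Gamma> \<and> (\<forall>\<eta>\<in>Q\<Gamma>. inner_curl \<Omega> e q \<eta> = l \<eta>)"
  proof (rule ex1_bilinear_form_on[OF curl_bilinear sub_Q\<Gamma> _ Q\<Gamma>_fin _ l])
    show "finite (weak_grad \<Omega> ` SW \<union> SG)" using SW(1) SG(1) by simp
    show "u = 0" if "u \<in> Q\<Gamma>" "\<forall>v\<in>Q\<Gamma>. inner_curl \<Omega> e u v = 0" for u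
      using that inner_curl_self_eq_0 by blast
  qed
  \<comment> \<open>With this \<open>w\<close> and \<open>\<gamma>\<close> the constraint holds
    because \<open>Xi\<close> vanishes there; every element of \<open>Q\<Gamma>\<close> being a
    value of \<open>Xi\<close>, the first equation says exactly that \<open>q\<close> represents
    \<open>l\<close>.\<close>
  have mixed_iff: "mixed_solution \<Omega> e a c F1 F2 W\<Gamma> G\<Gamma> Q\<Gamma> (w, \<gamma>, q)
      \<longleftrightarrow> q \<in> Q\<Gamma> \<and> (\<forall>\<eta>\<in>Q\<Gamma>. inner_curl \<Omega> e q \<eta> = l \<eta>)" for q
  proof (cases "q \<in> Q\<Gamma>")
    case True
    have "inner_curl \<Omega> e (Xi \<Omega> (w, \<gamma>)) \<eta> = 0" if "\<eta> \<in> Q\<Gamma>" for \<eta>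
      using curl_bilinear that linear_form_on_zero[OF _ sub_Q\<Gamma>, of "\<lambda>x. inner_curl \<Omega> e x \<eta>"]
      by (simp add: bilinear_form_on_def Xi_def \<gamma>_def)
    moreover have "a \<gamma> \<psi> + c w v + inner_curl \<Omega> e (Xi \<Omega> (v, \<psi>)) q = F1 \<psi> + F2 v
        \<longleftrightarrow> inner_curl \<Omega> e q (Xi \<Omega> (v, \<psi>)) = l (Xi \<Omega> (v, \<psi>))"
      if "v \<in> W\<Gamma>" "\<psi> \<in> G\<Gamma>" for v \<psi>
      using l_Xi[of "(v, \<psi>)"] that inner_curl_commute[of \<Omega> e q] by (auto simp: L_def)
    moreover have "(\<forall>\<eta>\<in>Q\<Gamma>. inner_curl \<Omega> e q \<eta> = l \<eta>)
        \<longleftrightarrow> (\<forall>v\<in>W\<Gamma>. \<forall>\<psi>\<in>G\<Gamma>. inner_curl \<Omega> e q (Xi \<Omega> (v, \<psi>)) = l (Xi \<Omega> (v, \<psi>)))"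
      unfolding Q\<Gamma> by blast
    ultimately show ?thesis
      using True w_W\<Gamma> \<gamma>_G\<Gamma> by (simp add: mixed_solution_def)
  qed (simp add: mixed_solution_def)
  have mixed: "\<exists>!s. mixed_solution \<Omega> e a c F1 F2 W\<Gamma> G\<Gamma> Q\<Gamma> s"
  proof -
    obtain q where q: "mixed_solution \<Omega> e a c F1 F2 W\<Gamma> G\<Gamma> Q\<Gamma> (w, \<gamma>, q)"
      using multiplier mixed_iff by blast
    have "s = (w, \<gamma>, q)" if s: "mixed_solution \<Omega> e a c F1 F2 W\<Gamma> G\<Gamma> Q\<Gamma> s" for s
    proof -
      obtain w' \<gamma>' q' where s_eq: "s = (w', \<gamma>', q')" by (cases s) auto
      \<comment> \<open>Any other solution has the same first two components, as both come from the
        one conforming solution; the multiplier is then determined by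
        \<open>mixed_iff\<close>.\<close>
      have "w' = w" "\<gamma>' = \<gamma>"
        using mixed_imp[OF split s[unfolded s_eq]] conforming w \<gamma>_def by blast+
      then show ?thesis using s q multiplier mixed_iff unfolding s_eq by blast
    qed
    then show ?thesis using q by blast
  qed
  have "w = wX \<and> \<gamma> = weak_grad \<Omega> wX"
    if "mixed_solution \<Omega> e a c F1 F2 W\<Gamma> G\<Gamma> Q\<Gamma> (w, \<gamma>, q)" "conforming_solution \<Omega> B F1 F2 WX wX"
    for w \<gamma> q wX
    using mixed_imp[OF split that(1)] conforming that(2) by blast
  \<comment> \<open>Both mixed problems reduce to the conforming one, which mentions only
    \<open>B\<close>.\<close>
  moreover have "w' = w"
    if "splitting \<Omega> B a' c'" "mixed_solution \<Omega> e a c F1 F2 W\<Gamma> G\<Gamma> Q\<Gamma> (w, \<gamma>, q)"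
      "mixed_solution \<Omega> e a' c' F1 F2 W\<Gamma> G\<Gamma> Q\<Gamma> (w', \<gamma>', q')" for a' c' w \<gamma> q w' \<gamma>' q'
    using mixed_imp[OF split that(2)] mixed_imp[OF that(1,3)] conforming by blast
  ultimately show ?thesis using WX_H2\<Gamma> mixed conforming by blast
qed

end
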